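(* Let $\emptyset\neq\omega\subseteq G\Subset\Omega\subset\mathbb{R}^n$ be bounded domains, and let $$\widehat\alpha:=\sup\big\{\alpha\colon \exists\, C_0 \text{ such that } \|w\|_{L_2(G)}\le C_0\|w\|_{L_2(\omega)}^{\alpha}\|w\|_{L_2(\Omega)}^{1-\alpha}\ \text{for all nonzero harmonic } w\in L_2(\Omega)\big\}.$$ Let $(X^\delta)_{\delta\in I}$ be a family of finite dimensional subspaces of $L_2(\Omega)$ whose union $\bigcup_{\delta\in I}X^\delta$ is dense in $L_2(\Omega)$. Let $\widetilde\alpha>\widehat\alpha$. Then there exists no scheme, i.e., no mapping $(\ell,q)\mapsto(u^\delta)_{\delta\in I}\in\prod_{\delta\in I}X^\delta$ defined on $H^{-2}(\Omega)\times L_2(\omega)$, that maps zero data $(\ell,q)=(0,0)$ onto $u^\delta=0$ for all $\delta\in I$, and for which there is a constant $K$ such that for all $\delta\in I$, $(\ell,q)\in H^{-2}(\Omega)\times L_2(\omega)$, and all nonzero $u\in L_2(\Omega)$, $$\|u-u^\delta\|_{L_2(G)}\le K\,\big(\mathcal{E}_{\rm data}+\mathcal{E}_{\rm appr}(\delta)\big)^{\widetilde\alpha}\,\max\big(\mathcal{E}_{\rm data}+\mathcal{E}_{\rm appr}(\delta),\,\|u\|_{L_2(\Omega)}\big)^{1-\widetilde\alpha},$$ where $\mathcal{E}_{\rm data}:=\|Au-(\ell,q)\|_{H^{-2}(\Omega)\times L_2(\omega)}$ and $\mathcal{E}_{\rm appr}(\delta):=\min_{z\in X^\delta}\|u-z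\|_{L_2(\Omega)}$.
   Context: A domain is a non-empty open connected set; $D\Subset E$ means that $\overline D$ is a compact subset of $E$. All spaces are real. $H^{-2}(\Omega)$ is the dual of $H^2_0(\Omega)$. The operator $A=(B,C)\in\mathcal{L}(L_2(\Omega),H^{-2}(\Omega)\times L_2(\omega))$ is defined by $(Bz)(v):=-\int_\Omega z\,\Delta v\,dx$ ($v\in H^2_0(\Omega)$) and $Cz:=z|_\omega$. The norm on the product is $(\|\cdot\|_{H^{-2}(\Omega)}^2+\|\cdot\|_{L_2(\omega)}^2)^{1/2}$. *)

theory Defs
  imports "HOL-Analysis.Analysis"
begin

definition sq_integrable :: "('a::euclidean_space \<Rightarrow> real) \<Rightarrow> bool" where
  "sq_integrable f \<longleftrightarrow> f \<in> borel_measurable lborel \<and> integrable lborel (\<lambda>x. (f x)\<^sup>2)"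

definition l2_eq :: "('a::euclidean_space \<Rightarrow> real) \<Rightarrow> ('a \<Rightarrow> real) \<Rightarrow> bool" where
  "l2_eq f g \<longleftrightarrow> sq_integrable f \<and> sq_integrable g \<and> (AE x in lborel. f x = g x)"

lemma sq_integrable_mult:
  assumes "sq_integrable f" "sq_integrable g"
  shows "integrable lborel (\<lambda>x. f x * g x)"
proof (rule Bochner_Integration.integrable_bound)
  show "integrable lborel (\<lambda>x. (f x)\<^sup>2 + (g x)\<^sup>2)"
    using assms by (auto simp: sq_integrable_def)
  show "(\<lambda>x. f x * g x) \<in> borel_measurable lborel"
    using assms by (auto simp: sq_integrable_def)
  show "AE x in lborel. norm (f x * g x) \<le> norm ((f x)\<^sup>2 + (g x)\<^sup>2)"
  proof (rule AE_I2)
    fix x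
    have "0 \<le> (\<bar>f x\<bar> - \<bar>g x\<bar>)\<^sup>2" by simp
    then have "2 * (\<bar>f x\<bar> * \<bar>g x\<bar>) \<le> (f x)\<^sup>2 + (g x)\<^sup>2"
      by (simp add: power2_diff)
    moreover have "0 \<le> \<bar>f x\<bar> * \<bar>g x\<bar>" by simp
    ultimately show "norm (f x * g x) \<le> norm ((f x)\<^sup>2 + (g x)\<^sup>2)"
      unfolding real_norm_def abs_mult by linarith
  qed
qed

lemma sq_integrable_zero: "sq_integrable (\<lambda>_. 0)"
  by (simp add: sq_integrable_def)

lemma sq_integrable_add:
  assumes "sq_integrable f" "sq_integrable g"
  shows "sq_integrable (\<lambda>x. f x + g x)"
proof -
  have "(\<lambda>x. (f x + g x)\<^sup>2) = (\<lambda>x. (f x)\<^sup>2 + (g x)\<^sup>2 + 2 * (f x * g x))"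
    by (auto simp: power2_sum)
  then show ?thesis
    using assms sq_integrable_mult[OF assms] by (auto simp: sq_integrable_def)
qed

lemma sq_integrable_scale:
  assumes "sq_integrable f"
  shows "sq_integrable (\<lambda>x. c * f x)"
  using assms by (auto simp: sq_integrable_def power_mult_distrib)

lemma sq_integrable_uminus: "sq_integrable f \<Longrightarrow> sq_integrable (\<lambda>x. - f x)"
  by (auto simp: sq_integrable_def)

lemma sq_integrable_diff:
  "sq_integrable f \<Longrightarrow> sq_integrable g \<Longrightarrow> sq_integrable (\<lambda>x. f x - g x)"
  using sq_integrable_add[OF _ sq_integrable_uminus, of f g] by simp

lemma sq_integrable_indicator_mult:
  assumes "sq_integrable f" "S \<in> sets borel"
  shows "sq_integrable (\<lambda>x. indicator S x * f x)"
proof -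
  have [measurable]: "f \<in> borel_measurable lborel" "S \<in> sets lborel"
    using assms by (auto simp: sq_integrable_def)
  have "integrable lborel (\<lambda>x. (indicator S x * f x)\<^sup>2)"
  proof (rule Bochner_Integration.integrable_bound)
    show "integrable lborel (\<lambda>x. (f x)\<^sup>2)"
      using assms by (auto simp: sq_integrable_def)
  qed (auto simp: indicator_def)
  then show ?thesis by (simp add: sq_integrable_def)
qed

text \<open>\<open>'a l2\<close> is $L_2$ of the whole space.  For an open set \<open>\<Omega>\<close>, the space $L_2(\Omega)$ is
  identified, via extension by zero, with the subspace \<open>L2_on \<Omega>\<close> below.\<close>

quotient_type (overloaded) 'a l2 = "'a::euclidean_space \<Rightarrow> real" / partial: l2_eq
proof (rule part_equivpI)
  show "\<exists>f::'a \<Rightarrow> real. l2_eq f f"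
    by (rule exI[of _ "\<lambda>_. 0"]) (simp add: l2_eq_def sq_integrable_zero)
  show "symp (l2_eq :: ('a \<Rightarrow> real) \<Rightarrow> _)"
    by (rule sympI) (auto simp: l2_eq_def elim: eventually_mono)
  show "transp (l2_eq :: ('a \<Rightarrow> real) \<Rightarrow> _)"
  proof (rule transpI)
    fix f g h :: "'a \<Rightarrow> real"
    assume "l2_eq f g" "l2_eq g h"
    then show "l2_eq f h" unfolding l2_eq_def by auto
  qed
qed

instantiation l2 :: (euclidean_space) real_inner
begin

lift_definition zero_l2 :: "'a l2" is "\<lambda>_. 0"
  by (simp add: l2_eq_def sq_integrable_zero)

lift_definition plus_l2 :: "'a l2 \<Rightarrow> 'a l2 \<Rightarrow> 'a l2" is "\<lambda>f g x. f x + g x"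
  by (auto simp: l2_eq_def intro!: sq_integrable_add)

lift_definition uminus_l2 :: "'a l2 \<Rightarrow> 'a l2" is "\<lambda>f x. - f x"
  by (auto simp: l2_eq_def intro!: sq_integrable_uminus)

lift_definition minus_l2 :: "'a l2 \<Rightarrow> 'a l2 \<Rightarrow> 'a l2" is "\<lambda>f g x. f x - g x"
  by (auto simp: l2_eq_def intro!: sq_integrable_diff)

lift_definition scaleR_l2 :: "real \<Rightarrow> 'a l2 \<Rightarrow> 'a l2" is "\<lambda>c f x. c * f x"
  by (auto simp: l2_eq_def intro!: sq_integrable_scale)

lift_definition inner_l2 :: "'a l2 \<Rightarrow> 'a l2 \<Rightarrow> real"
  is "\<lambda>f g. \<integral>x. f x * g x \<partial>lborel"
proof -
  fix f f' g g' :: "'a \<Rightarrow> real"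
  assume "l2_eq f f'" "l2_eq g g'"
  then show "(\<integral>x. f x * g x \<partial>lborel) = (\<integral>x. f' x * g' x \<partial>lborel)"
    by (intro integral_cong_AE) (auto simp: l2_eq_def sq_integrable_def)
qed

definition norm_l2 :: "'a l2 \<Rightarrow> real" where "norm_l2 f = sqrt (f \<bullet> f)"
definition dist_l2 :: "'a l2 \<Rightarrow> 'a l2 \<Rightarrow> real" where "dist_l2 f g = norm (f - g)"
definition sgn_l2 :: "'a l2 \<Rightarrow> 'a l2" where "sgn_l2 f = inverse (norm f) *\<^sub>R f"
definition uniformity_l2 :: "('a l2 \<times> 'a l2) filter" where
  "uniformity_l2 = (INF e\<in>{0 <..}. principal {(f, g). dist f g < e})"
definition open_l2 :: "'a l2 set \<Rightarrow> bool" where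
  "open_l2 U \<longleftrightarrow> (\<forall>f\<in>U. eventually (\<lambda>(f', g). f' = f \<longrightarrow> g \<in> U) uniformity)"

instance
proof
  fix a b c :: "'a l2" and r s :: real
  show "a + b + c = a + (b + c)"
    by transfer (auto simp: l2_eq_def add.assoc intro!: sq_integrable_add)
  show "a + b = b + a"
    by transfer (auto simp: l2_eq_def add.commute intro!: sq_integrable_add)
  show "0 + a = a"
    by transfer (auto simp: l2_eq_def)
  show "- a + a = 0"
    by transfer (auto simp: l2_eq_def sq_integrable_zero)
  show "a - b = a + - b"
    by transfer (auto simp: l2_eq_def intro!: sq_integrable_diff)
  show "r *\<^sub>R (a + b) = r *\<^sub>R a + r *\<^sub>R b"
    by transfer (auto simp: l2_eq_def distrib_left
        intro!: sq_integrable_add sq_integrable_scale)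
  show "(r + s) *\<^sub>R a = r *\<^sub>R a + s *\<^sub>R a"
    by transfer (auto simp: l2_eq_def distrib_right
        intro!: sq_integrable_add sq_integrable_scale)
  show "r *\<^sub>R s *\<^sub>R a = (r * s) *\<^sub>R a"
    by transfer (auto simp: l2_eq_def mult.assoc intro!: sq_integrable_scale)
  show "1 *\<^sub>R a = a"
    by transfer (auto simp: l2_eq_def)
  show "dist a b = norm (a - b)" by (rule dist_l2_def)
  show "sgn a = inverse (norm a) *\<^sub>R a" by (simp add: sgn_l2_def)
  show "uniformity = (INF e\<in>{0 <..}. principal {(f::'a l2, g). dist f g < e})"
    by (rule uniformity_l2_def)
  show "\<And>U :: 'a l2 set. open U \<longleftrightarrow>
      (\<forall>f\<in>U. eventually (\<lambda>(f', g). f' = f \<longrightarrow> g \<in> U) uniformity)"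
    by (rule open_l2_def)
  show "a \<bullet> b = b \<bullet> a"
    by transfer (simp add: mult.commute)
  show "(a + b) \<bullet> c = a \<bullet> c + b \<bullet> c"
    by transfer (auto simp: l2_eq_def distrib_right
        intro!: Bochner_Integration.integral_add sq_integrable_mult)
  show "(r *\<^sub>R a) \<bullet> b = r * (a \<bullet> b)"
    by transfer (simp add: mult.assoc)
  show "0 \<le> a \<bullet> a"
    by transfer simp
  show "a \<bullet> a = 0 \<longleftrightarrow> a = 0"
  proof transfer
    fix f :: "'a \<Rightarrow> real"
    assume "l2_eq f f"
    then have f: "sq_integrable f" by (simp add: l2_eq_def)
    have "(\<integral>x. f x * f x \<partial>lborel) = 0 \<longleftrightarrow> (AE x in lborel. f x * f x = 0)"
      using sq_integrable_mult[OF f f] by (intro integral_nonneg_eq_0_iff_AE) auto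
    then show "(\<integral>x. f x * f x \<partial>lborel) = 0 \<longleftrightarrow> l2_eq f (\<lambda>_. 0)"
      using f by (simp add: l2_eq_def sq_integrable_zero)
  qed
  show "norm a = sqrt (a \<bullet> a)" by (rule norm_l2_def)
qed

end

definition L2_on :: "'a::euclidean_space set \<Rightarrow> 'a l2 set" where
  "L2_on \<Omega> = {f. AE x in lborel. x \<notin> \<Omega> \<longrightarrow> rep_l2 f x = 0}"

text \<open>The restriction to \<open>S\<close>, again extended by zero.  The value for a set
  that is not Borel is irrelevant.\<close>

lift_definition restr :: "'a::euclidean_space set \<Rightarrow> 'a l2 \<Rightarrow> 'a l2"
  is "\<lambda>S f x. if S \<in> sets borel then indicator S x * f x else 0"
proof -
  fix S :: "'a set" and f g :: "'a \<Rightarrow> real"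
  assume "l2_eq f g"
  then show "l2_eq (\<lambda>x. if S \<in> sets borel then indicator S x * f x else 0)
      (\<lambda>x. if S \<in> sets borel then indicator S x * g x else 0)"
    by (cases "S \<in> sets borel")
       (auto simp: l2_eq_def sq_integrable_zero intro!: sq_integrable_indicator_mult)
qed

definition L2_norm :: "'a::euclidean_space set \<Rightarrow> 'a l2 \<Rightarrow> real" where
  "L2_norm S f = norm (restr S f)"

text \<open>On an open set, being differentiable with partial derivatives of class $C^k$
  is the same as being of class $C^{k+1}$.\<close>

definition partial :: "'a::euclidean_space \<Rightarrow> ('a \<Rightarrow> real) \<Rightarrow> 'a \<Rightarrow> real" where
  "partial b f x = frechet_derivative f (at x) b"

fun C_k_on :: "nat \<Rightarrow> 'a::euclidean_space set \<Rightarrow> ('a \<Rightarrow> real) \<Rightarrow> bool" where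
  "C_k_on 0 S f \<longleftrightarrow> continuous_on S f"
| "C_k_on (Suc k) S f \<longleftrightarrow>
     (\<forall>x\<in>S. f differentiable (at x)) \<and> (\<forall>b\<in>Basis. C_k_on k S (partial b f))"

definition test_functions :: "'a::euclidean_space set \<Rightarrow> ('a \<Rightarrow> real) set" where
  "test_functions \<Omega> =
     {\<phi>. (\<forall>k. C_k_on k UNIV \<phi>) \<and> (\<exists>K. compact K \<and> K \<subseteq> \<Omega> \<and> (\<forall>x. x \<notin> K \<longrightarrow> \<phi> x = 0))}"

definition harmonic_on :: "'a::euclidean_space set \<Rightarrow> ('a \<Rightarrow> real) \<Rightarrow> bool" where
  "harmonic_on \<Omega> f \<longleftrightarrow>
     C_k_on 2 \<Omega> f \<and> (\<forall>x\<in>\<Omega>. (\<Sum>b\<in>Basis. partial b (partial b f) x) = 0)"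

definition harmonic_L2 :: "'a::euclidean_space set \<Rightarrow> 'a l2 set" where
  "harmonic_L2 \<Omega> =
     {w \<in> L2_on \<Omega>. \<exists>f. harmonic_on \<Omega> f \<and> (AE x in lborel. x \<in> \<Omega> \<longrightarrow> rep_l2 w x = f x)}"

definition is_weak_partial ::
  "'a::euclidean_space set \<Rightarrow> 'a \<Rightarrow> 'a l2 \<Rightarrow> 'a l2 \<Rightarrow> bool" where
  "is_weak_partial \<Omega> b f g \<longleftrightarrow> g \<in> L2_on \<Omega> \<and>
     (\<forall>\<phi>\<in>test_functions \<Omega>.
        (\<integral>x. rep_l2 f x * partial b \<phi> x \<partial>lborel) = - (\<integral>x. rep_l2 g x * \<phi> x \<partial>lborel))"

text \<open>Weak derivatives are unique if they exist, which justifies the use of \<open>THE\<close>.\<close>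

definition weak_partial :: "'a::euclidean_space set \<Rightarrow> 'a \<Rightarrow> 'a l2 \<Rightarrow> 'a l2" where
  "weak_partial \<Omega> b f = (THE g. is_weak_partial \<Omega> b f g)"

definition H2 :: "'a::euclidean_space set \<Rightarrow> 'a l2 set" where
  "H2 \<Omega> = {f \<in> L2_on \<Omega>. \<forall>b\<in>Basis. \<exists>g. is_weak_partial \<Omega> b f g \<and>
     (\<forall>b'\<in>Basis. \<exists>h. is_weak_partial \<Omega> b' g h)}"

definition H2_norm :: "'a::euclidean_space set \<Rightarrow> 'a l2 \<Rightarrow> real" where
  "H2_norm \<Omega> f = sqrt ((norm f)\<^sup>2
     + (\<Sum>b\<in>Basis. (norm (weak_partial \<Omega> b f))\<^sup>2)
     + (\<Sum>b\<in>Basis. \<Sum>b'\<in>Basis. (norm (weak_partial \<Omega> b' (weak_partial \<Omega> b f)))\<^sup>2))"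

definition H20 :: "'a::euclidean_space set \<Rightarrow> 'a l2 set" where
  "H20 \<Omega> = {v \<in> H2 \<Omega>. \<forall>\<epsilon>>0. \<exists>\<phi>\<in>test_functions \<Omega>. H2_norm \<Omega> (v - abs_l2 \<phi>) < \<epsilon>}"

definition weak_laplacian :: "'a::euclidean_space set \<Rightarrow> 'a l2 \<Rightarrow> 'a l2" where
  "weak_laplacian \<Omega> v = (\<Sum>b\<in>Basis. weak_partial \<Omega> b (weak_partial \<Omega> b v))"

text \<open>Functionals on \<open>H20 \<Omega>\<close> are represented uniquely by requiring the value 0 off \<open>H20 \<Omega>\<close>.\<close>

definition Hm2 :: "'a::euclidean_space set \<Rightarrow> ('a l2 \<Rightarrow> real) set" where
  "Hm2 \<Omega> = {l. (\<forall>v. v \<notin> H20 \<Omega> \<longrightarrow> l v = 0)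
     \<and> (\<forall>u\<in>H20 \<Omega>. \<forall>v\<in>H20 \<Omega>. l (u + v) = l u + l v)
     \<and> (\<forall>c. \<forall>v\<in>H20 \<Omega>. l (c *\<^sub>R v) = c * l v)
     \<and> (\<exists>M. \<forall>v\<in>H20 \<Omega>. \<bar>l v\<bar> \<le> M * H2_norm \<Omega> v)}"

definition Hm2_norm :: "'a::euclidean_space set \<Rightarrow> ('a l2 \<Rightarrow> real) \<Rightarrow> real" where
  "Hm2_norm \<Omega> l = (SUP v\<in>{v \<in> H20 \<Omega>. H2_norm \<Omega> v \<le> 1}. \<bar>l v\<bar>)"

definition bounded_domain :: "'a::euclidean_space set \<Rightarrow> bool" where
  "bounded_domain D \<longleftrightarrow> D \<noteq> {} \<and> open D \<and> connected D \<and> bounded D"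

definition compactly_inside :: "'a::euclidean_space set \<Rightarrow> 'a set \<Rightarrow> bool" where
  "compactly_inside D E \<longleftrightarrow> compact (closure D) \<and> closure D \<subseteq> E"

definition op_B :: "'a::euclidean_space set \<Rightarrow> 'a l2 \<Rightarrow> 'a l2 \<Rightarrow> real" where
  "op_B \<Omega> z = (\<lambda>v. if v \<in> H20 \<Omega> then - (z \<bullet> weak_laplacian \<Omega> v) else 0)"

definition op_A ::
  "'a::euclidean_space set \<Rightarrow> 'a set \<Rightarrow> 'a l2 \<Rightarrow> ('a l2 \<Rightarrow> real) \<times> 'a l2" where
  "op_A \<Omega> \<omega> z = (op_B \<Omega> z, restr \<omega> z)"

definition data_norm ::
  "'a::euclidean_space set \<Rightarrow> 'a set \<Rightarrow> ('a l2 \<Rightarrow> real) \<times> 'a l2 \<Rightarrow> real" where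
  "data_norm \<Omega> \<omega> = (\<lambda>(l, q). sqrt ((Hm2_norm \<Omega> l)\<^sup>2 + (L2_norm \<omega> q)\<^sup>2))"

definition E_data :: "'a::euclidean_space set \<Rightarrow> 'a set \<Rightarrow> 'a l2 \<Rightarrow>
    ('a l2 \<Rightarrow> real) \<times> 'a l2 \<Rightarrow> real" where
  "E_data \<Omega> \<omega> u = (\<lambda>(l, q).
     data_norm \<Omega> \<omega> (\<lambda>v. fst (op_A \<Omega> \<omega> u) v - l v, snd (op_A \<Omega> \<omega> u) - q))"

text \<open>The minimum is attained, since \<open>X\<close> will be a finite dimensional subspace.\<close>

definition E_appr :: "'a::euclidean_space set \<Rightarrow> 'a l2 set \<Rightarrow> 'a l2 \<Rightarrow> real" where
  "E_appr \<Omega> X u = (INF z\<in>X. L2_norm \<Omega> (u - z))"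

definition is_scheme :: "'a::euclidean_space set \<Rightarrow> 'a set \<Rightarrow> 'i set \<Rightarrow> ('i \<Rightarrow> 'a l2 set) \<Rightarrow>
    (('a l2 \<Rightarrow> real) \<times> 'a l2 \<Rightarrow> 'i \<Rightarrow> 'a l2) \<Rightarrow> bool" where
  "is_scheme \<Omega> \<omega> I X U \<longleftrightarrow> (\<forall>d \<in> Hm2 \<Omega> \<times> L2_on \<omega>. \<forall>\<delta>\<in>I. U d \<delta> \<in> X \<delta>)"

text \<open>A nonzero harmonic function on the domain \<open>\<Omega>\<close> does not vanish on \<open>\<omega>\<close> (unique continuation),
  so the convention \<open>0 powr a = 0\<close> plays no role here.  The supremum is taken in the extended
  reals: it is infinite in dimension one, where harmonic functions are affine and
  the inequality holds for every exponent.\<close>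

definition alpha_hat ::
  "'a::euclidean_space set \<Rightarrow> 'a set \<Rightarrow> 'a set \<Rightarrow> ereal" where
  "alpha_hat \<omega> G \<Omega> = Sup (ereal ` {\<alpha>. \<exists>C\<^sub>0. \<forall>w\<in>harmonic_L2 \<Omega>. w \<noteq> 0 \<longrightarrow>
     L2_norm G w \<le> C\<^sub>0 * L2_norm \<omega> w powr \<alpha> * L2_norm \<Omega> w powr (1 - \<alpha>)})"

end

(*
Apply the scheme's estimate to the data (0, 0), for which u^delta = 0, and to a nonzero harmonic
u = w.  Then B w = 0, so the data error is |w|_omega, and by density the approximation error can be
made arbitrarily small.  In the limit |w|_G <= K |w|_omega^alpha' |w|_Omega^(1 - alpha'), so alpha'
is one of the exponents over which alpha_hat is the supremum.

The limit requires |w|_omega > 0, i.e. unique continuation for harmonic functions.  This is proved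
by polarization: for radial weights h, the integral of h(x) w(exp(t) x) w(exp(-t) x) does not
depend on t.  If w vanishes on the ball of radius r, then it therefore vanishes on the ball of every
radius rho with rho^2 < r R, where w is harmonic on the ball of radius R.

That B w = 0 on all of H^2_0, and not only on test functions, needs uniqueness of weak derivatives,
hence the smooth bump functions on boxes.
*)
theory Submission
  imports Defs
begin

text \<open>The weight is chosen as h(x) = (\<rho>^2 - |x|^2)_+^2 because h(x) x is then the
  gradient of a compactly supported C^1 function H. With u_t(x) = w(exp(t) x), the t-derivative of
  the integral of h u_t u_(-t) is the integral of grad H . (u_(-t) grad u_t - u_t grad u_(-t)), and
  Green's identity makes it 0 without a boundary term. So C^2 regularity of w and a divergence
  theorem for compactly supported fields suffice.

  The condition on the radii comes from two demands on t: exp(-t) \<rho> \<le> r puts one dilate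
  into the known zero set, and exp(t) \<rho> < R keeps the other inside the domain. Such a t exists
  exactly if \<rho>^2 < r R.

  Uniqueness of weak derivatives enters because \<open>weak_partial\<close> is a \<open>THE\<close>
  term: before uniqueness is known, \<open>weak_laplacian\<close> can neither be evaluated on a test
  function nor be split over a difference v - phi, and the passage from test functions to H^2_0
  requires both.\<close>

subsection \<open>Partial derivatives and the divergence theorem\<close>

lemma partial_has_derivative:
  "(f has_derivative f') (at x) \<Longrightarrow> partial b f x = f' b"
  using frechet_derivative_at[of f f' x] by (simp add: partial_def)

lemma has_derivative_partial:
  "f differentiable (at x) \<Longrightarrow> (f has_derivative (\<lambda>v. partial v f x)) (at x)"
  by (simp add: frechet_derivative_works partial_def[abs_def])

text \<open>Functions that agree near x have the same derivatives there, or both have none, so the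
  choice made by \<open>frechet_derivative\<close> is the same term in both cases.\<close>

lemma partial_cong:
  assumes "open S" "x \<in> S" "\<And>y. y \<in> S \<Longrightarrow> f y = g y"
  shows "partial b f x = partial b g x"
proof -
  have "(f has_derivative D) (at x) \<longleftrightarrow> (g has_derivative D) (at x)" for D
    using has_derivative_transform_within_open[of f D x UNIV S g]
      has_derivative_transform_within_open[of g D x UNIV S f] assms by auto
  then show ?thesis by (simp add: partial_def frechet_derivative_def)
qed

lemma differentiable_cong_open:
  assumes "open S" "x \<in> S" "\<And>y. y \<in> S \<Longrightarrow> f y = g y" "f differentiable (at x)"
  shows "g differentiable (at x)"
  using assms has_derivative_transform_within_open[of f _ x UNIV S g]
  by (auto simp: differentiable_def)

lemma partial_add:
  assumes "f differentiable (at x)" "g differentiable (at x)"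
  shows "partial b (\<lambda>x. f x + g x) x = partial b f x + partial b g x"
  by (rule partial_has_derivative)
     (intro has_derivative_add has_derivative_partial assms)

lemma partial_diff:
  assumes "f differentiable (at x)" "g differentiable (at x)"
  shows "partial b (\<lambda>x. f x - g x) x = partial b f x - partial b g x"
  by (rule partial_has_derivative)
     (intro has_derivative_diff has_derivative_partial assms)

lemma partial_mult:
  assumes "f differentiable (at x)" "g differentiable (at x)"
  shows "partial b (\<lambda>x. f x * g x) x = f x * partial b g x + partial b f x * g x"
  by (rule partial_has_derivative)
     (intro has_derivative_mult has_derivative_partial assms)

lemma partial_const: "partial b (\<lambda>x. c) x = 0"
  by (rule partial_has_derivative) (rule has_derivative_const)

lemma partial_eq_sum_Basis:
  assumes "f differentiable (at x)"
  shows "partial v f x = (\<Sum>b\<in>Basis. (v \<bullet> b) * partial b f x)"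
proof -
  interpret linear "\<lambda>v. partial v f x"
    using has_derivative_partial[OF assms] by (rule has_derivative_linear)
  have "partial v f x = partial (\<Sum>b\<in>Basis. (v \<bullet> b) *\<^sub>R b) f x"
    by (simp add: euclidean_representation)
  then show ?thesis by (simp add: sum scale)
qed

text \<open>Passes from the Lebesgue integral over the whole space to the integral over a box, to
  which \<open>leibniz_rule_field_derivative\<close> applies.\<close>

lemma lborel_integral_eq_cbox:
  fixes f :: "'a::euclidean_space \<Rightarrow> real"
  assumes "continuous_on (cbox a b) f" "\<And>x. x \<notin> cbox a b \<Longrightarrow> f x = 0"
  shows "integrable lborel f" "(\<integral>x. f x \<partial>lborel) = integral (cbox a b) f"
proof -
  have f: "f = (\<lambda>x. indicator (cbox a b) x *\<^sub>R f x)"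
    using assms(2) by (intro ext) (auto simp: indicator_def)
  have int: "set_integrable lborel (cbox a b) f"
    unfolding set_integrable_def by (intro borel_integrable_compact assms) auto
  then show "integrable lborel f"
    unfolding set_integrable_def f[symmetric] .
  show "(\<integral>x. f x \<partial>lborel) = integral (cbox a b) f"
    using set_borel_integral_eq_integral(2)[OF int]
    unfolding set_lebesgue_integral_def f[symmetric] by simp
qed

text \<open>A box that supports all \<open>F t\<close> at once reduces differentiation under the
  integral to the Leibniz rule on a compact set.\<close>

lemma has_real_derivative_lborel_integral:
  fixes F F' :: "real \<Rightarrow> 'a::euclidean_space \<Rightarrow> real"
  assumes der: "\<And>t x. t \<in> U \<Longrightarrow> ((\<lambda>t. F t x) has_real_derivative F' t x) (at t within U)"
    and contF: "\<And>t. t \<in> U \<Longrightarrow> continuous_on UNIV (F t)"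
    and contF': "continuous_on (U \<times> UNIV) (\<lambda>(t, x). F' t x)"
    and F0: "\<And>t x. t \<in> U \<Longrightarrow> x \<notin> cbox a b \<Longrightarrow> F t x = 0"
    and F'0: "\<And>t x. t \<in> U \<Longrightarrow> x \<notin> cbox a b \<Longrightarrow> F' t x = 0"
    and U: "t \<in> U" "convex U"
  shows "((\<lambda>t. \<integral>x. F t x \<partial>lborel) has_real_derivative (\<integral>x. F' t x \<partial>lborel)) (at t within U)"
proof -
  have "((\<lambda>t. integral (cbox a b) (F t)) has_field_derivative integral (cbox a b) (F' t)) (at t within U)"
    using U
  proof (intro leibniz_rule_field_derivative)
    show "continuous_on (U \<times> cbox a b) (\<lambda>(t, x). F' t x)"
      by (rule continuous_on_subset[OF contF']) auto
  qed (auto intro: der integrable_continuous continuous_on_subset[OF contF])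
  moreover have "(\<integral>x. F' t x \<partial>lborel) = integral (cbox a b) (F' t)"
  proof (rule lborel_integral_eq_cbox(2))
    have "continuous_on (cbox a b) (\<lambda>x. (\<lambda>(t, x). F' t x) (t, x))"
      by (rule continuous_on_compose2[OF contF']) (use U in \<open>auto intro!: continuous_intros\<close>)
    then show "continuous_on (cbox a b) (F' t)" by simp
  qed (use F'0 U in auto)
  moreover have "(\<integral>x. F s x \<partial>lborel) = integral (cbox a b) (F s)" if "s \<in> U" for s
    using that by (intro lborel_integral_eq_cbox(2) continuous_on_subset[OF contF] F0) auto
  ultimately show ?thesis
    using U has_derivative_transform[of t U "\<lambda>t. \<integral>x. F t x \<partial>lborel" "\<lambda>t. integral (cbox a b) (F t)"]
    by (simp add: has_field_derivative_def)
qed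

text \<open>By translation invariance \<open>\<integral> g (x + t *\<^sub>R b)\<close> does not depend on \<open>t\<close>; differentiate at \<open>t = 0\<close>.\<close>

lemma integral_partial_eq_0:
  fixes g :: "'a::euclidean_space \<Rightarrow> real"
  assumes diff: "\<And>x. g differentiable (at x)"
    and cont: "continuous_on UNIV (partial b g)"
    and K: "compact K" "\<And>x. x \<notin> K \<Longrightarrow> g x = 0"
  shows "(\<integral>x. partial b g x \<partial>lborel) = 0"
proof -
  let ?U = "{-1<..<1::real}"
  obtain d where d: "K \<subseteq> cbox (-d) d"
    using bounded_subset_cbox_symmetric[OF compact_imp_bounded[OF K(1)]] by metis
  \<comment> \<open>The box is widened by |b_i| in each direction, so that it contains the support
    of every translate with |t| < 1.\<close>
  define c where "c = d + (\<Sum>i\<in>Basis. \<bar>b \<bullet> i\<bar> *\<^sub>R i)"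
  have inK: "x + t *\<^sub>R b \<notin> K" if "t \<in> ?U" "x \<notin> cbox (-c) c" for t x
  proof
    assume "x + t *\<^sub>R b \<in> K"
    then have "x + t *\<^sub>R b \<in> cbox (-d) d" using d by blast
    then have *: "\<bar>x \<bullet> i + t * (b \<bullet> i)\<bar> \<le> d \<bullet> i" if "i \<in> Basis" for i
      using that by (force simp: mem_box inner_simps)
    have "\<bar>x \<bullet> i\<bar> \<le> c \<bullet> i" if i: "i \<in> Basis" for i
    proof -
      have "\<bar>t * (b \<bullet> i)\<bar> \<le> \<bar>b \<bullet> i\<bar>"
        using \<open>t \<in> ?U\<close> by (auto simp: abs_mult intro!: mult_left_le_one_le)
      moreover have "c \<bullet> i = d \<bullet> i + \<bar>b \<bullet> i\<bar>"
        using i by (simp add: c_def inner_simps)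
      ultimately show ?thesis using *[OF i] by linarith
    qed
    then have "x \<in> cbox (-c) c" by (force simp: mem_box abs_le_iff)
    with that(2) show False by simp
  qed
  have p0: "partial b g x = 0" if "x \<notin> K" for x
    using partial_cong[of "- K" x g "\<lambda>_. 0" b] K that partial_const[of b 0 x]
    by (auto simp: compact_imp_closed open_Compl)
  have contg: "continuous_on UNIV g"
    using diff by (auto intro!: continuous_at_imp_continuous_on differentiable_imp_continuous_within)
  have "((\<lambda>t. \<integral>x. g (x + t *\<^sub>R b) \<partial>lborel) has_real_derivative (\<integral>x. partial b g (x + 0 *\<^sub>R b) \<partial>lborel))
      (at 0 within ?U)"
  proof (rule has_real_derivative_lborel_integral[where a="-c" and b=c])
    fix t x assume "t \<in> ?U"
    have "((\<lambda>t. g (x + t *\<^sub>R b)) has_derivative (\<lambda>h. partial (h *\<^sub>R b) g (x + t *\<^sub>R b))) (at t within ?U)"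
      by (rule has_derivative_compose[of "\<lambda>t. x + t *\<^sub>R b" "\<lambda>h. h *\<^sub>R b", OF _ has_derivative_partial[OF diff]])
         (auto intro!: derivative_eq_intros)
    moreover have "partial (h *\<^sub>R b) g y = h * partial b g y" for h y
      using linear_cmul[OF has_derivative_linear[OF has_derivative_partial[OF diff]]] by auto
    ultimately show "((\<lambda>t. g (x + t *\<^sub>R b)) has_real_derivative partial b g (x + t *\<^sub>R b)) (at t within ?U)"
      by (simp add: has_field_derivative_def mult_commute_abs)
  next
    fix t assume "t \<in> ?U"
    show "continuous_on UNIV (\<lambda>x. g (x + t *\<^sub>R b))"
      by (rule continuous_on_compose2[OF contg]) (auto intro!: continuous_intros)
  next
    show "continuous_on (?U \<times> UNIV) (\<lambda>(t, x). partial b g (x + t *\<^sub>R b))"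
      unfolding split_beta by (rule continuous_on_compose2[OF cont]) (auto intro!: continuous_intros)
  next
    fix t x assume "t \<in> ?U" "x \<notin> cbox (-c) c"
    then show "g (x + t *\<^sub>R b) = 0" "partial b g (x + t *\<^sub>R b) = 0"
      using K p0 inK by auto
  qed auto
  moreover have "(\<integral>x. g (x + t *\<^sub>R b) \<partial>lborel) = (\<integral>x. g x \<partial>lborel)" for t
  proof -
    have "(\<integral>x. g x \<partial>lborel) = (\<integral>x. g x \<partial>(distr lborel borel ((+) (t *\<^sub>R b))))"
      by (simp add: lborel_distr_plus)
    also have "\<dots> = (\<integral>x. g (t *\<^sub>R b + x) \<partial>lborel)"
      using contg by (intro integral_distr) (auto intro: borel_measurable_continuous_onI)
    finally show ?thesis by (simp add: add.commute)
  qed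
  ultimately have "((\<lambda>t. \<integral>x. g x \<partial>lborel) has_real_derivative (\<integral>x. partial b g x \<partial>lborel)) (at 0)"
    by (simp add: at_within_open[of 0 ?U])
  then show ?thesis using DERIV_const DERIV_unique by blast
qed

text \<open>Regularity is local, and the open sets \<open>S\<close> and \<open>- K\<close> cover the
  space; on \<open>- K\<close> the function is locally 0.\<close>

lemma extend_by_zero:
  fixes g :: "'a::euclidean_space \<Rightarrow> real"
  assumes "open S" "closed K" "K \<subseteq> S" "\<And>x. x \<notin> K \<Longrightarrow> g x = 0"
  shows "\<lbrakk>\<And>x. x \<in> S \<Longrightarrow> g differentiable (at x)\<rbrakk> \<Longrightarrow> g differentiable (at x)"
    and "continuous_on S g \<Longrightarrow> continuous_on UNIV g"
    and "continuous_on S (partial b g) \<Longrightarrow> continuous_on UNIV (partial b g)"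
    and "x \<notin> K \<Longrightarrow> partial b g x = 0"
proof -
  have K: "open (- K)" using assms by auto
  have U: "UNIV = S \<union> - K" using assms by auto
  have p0: "partial b g x = 0" if "x \<notin> K" for x
    using partial_cong[OF K, of x g "\<lambda>_. 0" b] assms(4) that partial_const[of b 0 x] by auto
  then show "x \<notin> K \<Longrightarrow> partial b g x = 0" .
  show "g differentiable (at x)" if "\<And>x. x \<in> S \<Longrightarrow> g differentiable (at x)"
  proof (cases "x \<in> S")
    case False
    show ?thesis
      by (rule differentiable_cong_open[OF K, of x "\<lambda>_. 0"]) (use False assms in auto)
  qed (rule that)
  show "continuous_on UNIV g" if "continuous_on S g"
    unfolding U
    by (rule continuous_on_open_Un[OF assms(1) K that continuous_on_eq[OF continuous_on_const[of _ 0]]])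
       (use assms(4) in auto)
  show "continuous_on UNIV (partial b g)" if "continuous_on S (partial b g)"
    unfolding U
    by (rule continuous_on_open_Un[OF assms(1) K that continuous_on_eq[OF continuous_on_const[of _ 0]]])
       (use p0 in auto)
qed

text \<open>The fields to come are regular only on the domain \<open>S\<close> of a harmonic
  function. Support in a compact part of \<open>S\<close> makes their zero extensions regular
  everywhere, and \<open>integral_partial_eq_0\<close> applies to each component.\<close>

lemma integral_divergence_eq_0:
  fixes P :: "'a::euclidean_space \<Rightarrow> 'a \<Rightarrow> real"
  assumes S: "open S" "compact K" "K \<subseteq> S"
    and P0: "\<And>b x. b \<in> Basis \<Longrightarrow> x \<notin> K \<Longrightarrow> P b x = 0"
    and diff: "\<And>b x. b \<in> Basis \<Longrightarrow> x \<in> S \<Longrightarrow> P b differentiable (at x)"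
    and cont: "\<And>b. b \<in> Basis \<Longrightarrow> continuous_on S (partial b (P b))"
  shows "(\<integral>x. (\<Sum>b\<in>Basis. partial b (P b) x) \<partial>lborel) = 0"
proof -
  note ext = extend_by_zero[OF S(1) compact_imp_closed[OF S(2)] S(3), of "P b" for b, OF P0]
  obtain c where c: "K \<subseteq> cbox (-c) c"
    using bounded_subset_cbox_symmetric[OF compact_imp_bounded[OF S(2)]] by metis
  have "integrable lborel (partial b (P b))" if "b \<in> Basis" for b
  proof (rule lborel_integral_eq_cbox(1)[of "-c" c])
    show "continuous_on (cbox (-c) c) (partial b (P b))"
      using continuous_on_subset[OF ext(3)[OF that _ cont[OF that]] subset_UNIV] by simp
    show "partial b (P b) x = 0" if "x \<notin> cbox (-c) c" for x
      using \<open>b \<in> Basis\<close> that c by (intro ext(4)) auto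
  qed
  then have "(\<integral>x. (\<Sum>b\<in>Basis. partial b (P b) x) \<partial>lborel)
      = (\<Sum>b\<in>Basis. \<integral>x. partial b (P b) x \<partial>lborel)"
    by (simp add: integral_sum)
  also have "\<dots> = 0"
  proof (intro sum.neutral ballI)
    fix b :: 'a assume b: "b \<in> Basis"
    show "(\<integral>x. partial b (P b) x \<partial>lborel) = 0"
    proof (rule integral_partial_eq_0[OF ext(1)[OF b _ diff[OF b]] ext(3)[OF b _ cont[OF b]] S(2) P0[OF b]])
    qed auto
  qed
  finally show ?thesis .
qed

subsection \<open>Unique continuation for harmonic functions\<close>

lemma C2_onD:
  assumes "C_k_on 2 S f"
  shows "x \<in> S \<Longrightarrow> f differentiable (at x)"
    and "x \<in> S \<Longrightarrow> b \<in> Basis \<Longrightarrow> partial b f differentiable (at x)"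
    and "b \<in> Basis \<Longrightarrow> b' \<in> Basis \<Longrightarrow> continuous_on S (partial b' (partial b f))"
    and "continuous_on S f"
    and "b \<in> Basis \<Longrightarrow> continuous_on S (partial b f)"
  using assms
  by (auto simp: numeral_2_eq_2 intro!: continuous_at_imp_continuous_on
      differentiable_imp_continuous_within)

lemma partial_affine:
  fixes f :: "'a::euclidean_space \<Rightarrow> real"
  assumes "f differentiable (at (y + s *\<^sub>R x))"
  shows "(\<lambda>x. f (y + s *\<^sub>R x)) differentiable (at x)"
    and "partial b (\<lambda>x. f (y + s *\<^sub>R x)) x = s * partial b f (y + s *\<^sub>R x)"
proof -
  have *: "((\<lambda>x. f (y + s *\<^sub>R x)) has_derivative (\<lambda>v. partial (s *\<^sub>R v) f (y + s *\<^sub>R x))) (at x)"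
    by (rule has_derivative_compose[of "\<lambda>x. y + s *\<^sub>R x", OF _ has_derivative_partial[OF assms]])
       (auto intro!: derivative_eq_intros)
  then show "(\<lambda>x. f (y + s *\<^sub>R x)) differentiable (at x)"
    by (auto simp: differentiable_def)
  show "partial b (\<lambda>x. f (y + s *\<^sub>R x)) x = s * partial b f (y + s *\<^sub>R x)"
    using partial_has_derivative[OF *, of b]
      linear_cmul[OF has_derivative_linear[OF has_derivative_partial[OF assms]]] by simp
qed

text \<open>Two applications of the chain rule multiply the Laplacian by s^2. This serves for the
  dilates in the polarization and, with \<open>y = 0\<close> and \<open>s = 1\<close>, for
  restriction to a smaller open set.\<close>

lemma harmonic_on_affine:
  fixes f :: "'a::euclidean_space \<Rightarrow> real"
  assumes S: "open S" and f: "harmonic_on S f" and T: "open T" "(\<lambda>x. y + s *\<^sub>R x) ` T \<subseteq> S"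
  shows "harmonic_on T (\<lambda>x. f (y + s *\<^sub>R x))"
proof -
  let ?u = "\<lambda>x. f (y + s *\<^sub>R x)"
  have C2: "C_k_on 2 S f" and lap: "\<And>x. x \<in> S \<Longrightarrow> (\<Sum>b\<in>Basis. partial b (partial b f) x) = 0"
    using f by (auto simp: harmonic_on_def)
  note D = C2_onD[OF C2]
  have inS: "y + s *\<^sub>R x \<in> S" if "x \<in> T" for x using T that by auto
  have d1: "?u differentiable (at x)" "partial b ?u x = s * partial b f (y + s *\<^sub>R x)" if "x \<in> T" for x b
    using partial_affine[of f y s x] D(1) inS[OF that] by auto
  have d2: "(\<lambda>x. s * partial b f (y + s *\<^sub>R x)) differentiable (at x)"
    "partial b' (\<lambda>x. s * partial b f (y + s *\<^sub>R x)) x = s * (s * partial b' (partial b f) (y + s *\<^sub>R x))"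
    if "x \<in> T" "b \<in> Basis" for x b b'
    using partial_affine[of "partial b f" y s x] D(2) inS[OF that(1)] that(2)
    by (auto simp: partial_mult partial_const)
  have d3: "partial b ?u differentiable (at x)"
    "partial b' (partial b ?u) x = s * (s * partial b' (partial b f) (y + s *\<^sub>R x))"
    if "x \<in> T" "b \<in> Basis" for x b b'
  proof -
    show "partial b ?u differentiable (at x)"
      by (rule differentiable_cong_open[OF T(1) that(1) _ d2(1)[OF that]]) (simp add: d1)
    have "partial b' (partial b ?u) x = partial b' (\<lambda>x. s * partial b f (y + s *\<^sub>R x)) x"
      by (rule partial_cong[OF T(1) that(1)]) (simp add: d1)
    then show "partial b' (partial b ?u) x = s * (s * partial b' (partial b f) (y + s *\<^sub>R x))"
      using d2(2)[OF that] by simp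
  qed
  have cont: "continuous_on T (partial b' (partial b ?u))" if "b \<in> Basis" "b' \<in> Basis" for b b'
  proof (rule continuous_on_eq)
    show "continuous_on T (\<lambda>x. s * (s * partial b' (partial b f) (y + s *\<^sub>R x)))"
      by (intro continuous_intros continuous_on_compose2[OF D(3)[OF that] _ T(2)])
    show "s * (s * partial b' (partial b f) (y + s *\<^sub>R x)) = partial b' (partial b ?u) x" if "x \<in> T" for x
      using d3(2)[OF that] \<open>b \<in> Basis\<close> by simp
  qed
  have "(\<Sum>b\<in>Basis. partial b (partial b ?u) x) = 0" if "x \<in> T" for x
    using lap[OF inS[OF that]] by (simp add: d3(2)[OF that] sum_distrib_left[symmetric])
  then show ?thesis
    using d1(1) d3(1) cont by (simp add: harmonic_on_def numeral_2_eq_2)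
qed

text \<open>The cube smooths the kink of \<open>max\<close> at 0, where the difference quotient is
  at most h^2.\<close>

lemma DERIV_pos_part_cube:
  "((\<lambda>s::real. max 0 s ^ 3) has_real_derivative 3 * (max 0 s)\<^sup>2) (at s)"
proof -
  consider "s < 0" | "s > 0" | "s = 0" by linarith
  then show ?thesis
  proof cases
    case 1
    have "((\<lambda>s::real. max 0 s ^ 3) has_real_derivative 0) (at s)"
      by (rule has_field_derivative_transform_within_open[OF DERIV_const[of 0], of "{..<0}"])
         (use 1 in auto)
    with 1 show ?thesis by simp
  next
    case 2
    have "((\<lambda>s::real. s ^ 3) has_real_derivative 3 * s\<^sup>2) (at s)"
      by (auto intro!: derivative_eq_intros)
    then have "((\<lambda>s::real. max 0 s ^ 3) has_real_derivative 3 * s\<^sup>2) (at s)"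
      by (rule has_field_derivative_transform_within_open[of _ _ _ "{0<..}"]) (use 2 in auto)
    with 2 show ?thesis by simp
  next
    case 3
    have "((\<lambda>h::real. max 0 h ^ 3 / h) \<longlongrightarrow> 0) (at 0)"
    proof (rule Lim_null_comparison)
      show "\<forall>\<^sub>F h in at 0. norm (max 0 h ^ 3 / h) \<le> h\<^sup>2"
        by (intro always_eventually) (auto simp: max_def power3_eq_cube power2_eq_square)
      have "isCont (\<lambda>h::real. h\<^sup>2) 0" by (intro continuous_intros)
      then show "((\<lambda>h::real. h\<^sup>2) \<longlongrightarrow> 0) (at 0)" by (simp add: isCont_def)
    qed
    with 3 show ?thesis by (simp add: DERIV_def)
  qed
qed

text \<open>Divergence theorem for the field \<open>H (v \<nabla>u - u \<nabla>v)\<close> with \<open>H = - (\<rho>\<^sup>2 - |x|\<^sup>2)\<^sub>+\<^sup>3 / 6\<close>, whose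
  gradient is radial.\<close>

lemma integral_radial_Green_eq_0:
  fixes u v :: "'a::euclidean_space \<Rightarrow> real"
  assumes u: "harmonic_on (ball 0 R) u" and v: "harmonic_on (ball 0 R) v" and \<rho>: "0 \<le> \<rho>" "\<rho> < R"
  shows "(\<integral>x. (max 0 (\<rho>\<^sup>2 - (norm x)\<^sup>2))\<^sup>2 *
      (\<Sum>b\<in>Basis. (x \<bullet> b) * (v x * partial b u x - u x * partial b v x)) \<partial>lborel) = 0"
proof -
  let ?S = "ball (0::'a) R" and ?K = "cball (0::'a) \<rho>"
  let ?m = "\<lambda>x::'a. max 0 (\<rho>\<^sup>2 - (norm x)\<^sup>2)"
  \<comment> \<open>The 6 cancels the 3 from the cube and the 2 from the gradient of |x|^2, so the
    gradient of \<open>?H\<close> is exactly \<open>(?m x)\<^sup>2\<close> times x.\<close>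
  let ?H = "\<lambda>x::'a. - (?m x ^ 3) / 6"
  have C2: "C_k_on 2 ?S u" "C_k_on 2 ?S v"
    and lapu: "\<And>x. x \<in> ?S \<Longrightarrow> (\<Sum>b\<in>Basis. partial b (partial b u) x) = 0"
    and lapv: "\<And>x. x \<in> ?S \<Longrightarrow> (\<Sum>b\<in>Basis. partial b (partial b v) x) = 0"
    using u v by (auto simp: harmonic_on_def)
  note Du = C2_onD[OF C2(1)] and Dv = C2_onD[OF C2(2)]
  have dH: "(?H has_derivative (\<lambda>h. (?m x)\<^sup>2 * (x \<bullet> h))) (at x)" for x
  proof -
    have "((\<lambda>x::'a. \<rho>\<^sup>2 - (norm x)\<^sup>2) has_derivative (\<lambda>h. - (2 * (x \<bullet> h)))) (at x)"
      unfolding power2_norm_eq_inner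
      by (auto intro!: derivative_eq_intros simp: inner_commute)
    then have "((\<lambda>x. max 0 (\<rho>\<^sup>2 - (norm x)\<^sup>2) ^ 3) has_derivative
        (\<lambda>h. 3 * (?m x)\<^sup>2 * - (2 * (x \<bullet> h)))) (at x)"
      by (rule has_derivative_compose[OF _ DERIV_pos_part_cube[unfolded has_field_derivative_def]])
    then have "((\<lambda>x. (- 1 / 6) * max 0 (\<rho>\<^sup>2 - (norm x)\<^sup>2) ^ 3) has_derivative
        (\<lambda>h. (- 1 / 6) * (3 * (?m x)\<^sup>2 * - (2 * (x \<bullet> h))))) (at x)"
      by (rule has_derivative_mult_right)
    then show ?thesis by (simp add: algebra_simps)
  qed
  have pH: "?H differentiable (at x)" "partial b ?H x = (?m x)\<^sup>2 * (x \<bullet> b)" for x b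
    using dH[of x] partial_has_derivative[OF dH] by (auto simp: differentiable_def)
  define W where "W b x = v x * partial b u x - u x * partial b v x" for b x
  \<comment> \<open>The products of first derivatives cancel, so the divergence of \<open>W\<close>
    is v Lap u - u Lap v.\<close>
  have dW: "W b differentiable (at x)"
    "partial b (W b) x = v x * partial b (partial b u) x - u x * partial b (partial b v) x"
    if "b \<in> Basis" "x \<in> ?S" for b x
    using that Du(1,2)[of x] Dv(1,2)[of x]
    by (auto simp: W_def[abs_def] partial_diff partial_mult)
  define P where "P b x = ?H x * W b x" for b x
  have dP: "P b differentiable (at x)"
    "partial b (P b) x = ?H x * (v x * partial b (partial b u) x - u x * partial b (partial b v) x)
        + (?m x)\<^sup>2 * (x \<bullet> b) * W b x"
    if "b \<in> Basis" "x \<in> ?S" for b x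
  proof -
    note d = pH(1)[of x] dW(1)[OF that]
    show "P b differentiable (at x)"
      unfolding P_def by (rule differentiable_mult[OF d])
    show "partial b (P b) x = ?H x * (v x * partial b (partial b u) x - u x * partial b (partial b v) x)
        + (?m x)\<^sup>2 * (x \<bullet> b) * W b x"
      unfolding P_def partial_mult[OF d] pH(2) dW(2)[OF that] ..
  qed
  have "(\<integral>x. (\<Sum>b\<in>Basis. partial b (P b) x) \<partial>lborel) = 0"
  proof (rule integral_divergence_eq_0)
    show "open ?S" "compact ?K" "?K \<subseteq> ?S" using \<open>\<rho> < R\<close> by auto
    show "P b x = 0" if "x \<notin> ?K" for b x
    proof -
      have "\<rho>\<^sup>2 \<le> (norm x)\<^sup>2" using that \<rho> by (intro power_mono) auto
      then show ?thesis by (simp add: P_def)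
    qed
    show "P b differentiable (at x)" if "b \<in> Basis" "x \<in> ?S" for b x
      using dP that by blast
    show "continuous_on ?S (partial b (P b))" if "b \<in> Basis" for b
    proof (rule continuous_on_eq)
      show "continuous_on ?S (\<lambda>x. ?H x * (v x * partial b (partial b u) x - u x * partial b (partial b v) x)
        + (?m x)\<^sup>2 * (x \<bullet> b) * W b x)"
        unfolding W_def using that by (intro continuous_intros Du Dv) auto
    qed (use dP that in simp)
  qed
  \<comment> \<open>Inside \<open>?S\<close> harmonicity removes the term with \<open>?H\<close> and
    leaves grad \<open>?H\<close> . \<open>W\<close>. Outside \<open>?S\<close>, where u and v are
    arbitrary, the cutoff makes both sides 0.\<close>
  also have "(\<lambda>x. (\<Sum>b\<in>Basis. partial b (P b) x)) = (\<lambda>x. (?m x)\<^sup>2 * (\<Sum>b\<in>Basis. (x \<bullet> b) * W b x))"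
  proof
    fix x
    show "(\<Sum>b\<in>Basis. partial b (P b) x) = (?m x)\<^sup>2 * (\<Sum>b\<in>Basis. (x \<bullet> b) * W b x)"
    proof (cases "x \<in> ?S")
      case True
      have "(\<Sum>b\<in>Basis. partial b (P b) x) =
          ?H x * (v x * (\<Sum>b\<in>Basis. partial b (partial b u) x) - u x * (\<Sum>b\<in>Basis. partial b (partial b v) x))
          + (?m x)\<^sup>2 * (\<Sum>b\<in>Basis. (x \<bullet> b) * W b x)"
        using True by (simp only: dP(2) sum.distrib sum_subtractf sum_distrib_left right_diff_distrib mult.assoc cong: sum.cong)
      with lapu[OF True] lapv[OF True] show ?thesis by simp
    next
      case False
      have *: "\<rho>\<^sup>2 \<le> (norm y)\<^sup>2" if "\<rho> < norm y" for y :: 'a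
        using that \<open>\<rho> \<ge> 0\<close> by (intro power_mono) auto
      have "partial b (P b) x = 0" for b
        using partial_cong[of "- ?K" x "P b" "\<lambda>_. 0" b] False \<open>\<rho> < R\<close>
        by (auto simp: open_Compl P_def partial_const * not_le)
      moreover have "?m x = 0" using *[of x] False \<open>\<rho> < R\<close> by simp
      ultimately show ?thesis by simp
    qed
  qed
  finally show ?thesis by (simp add: W_def)
qed


text \<open>The set where f is nonzero is open and null, and a nonempty open set is not
  negligible.\<close>

lemma continuous_AE_eq_0:
  fixes f :: "'a::euclidean_space \<Rightarrow> real"
  assumes "open S" "continuous_on S f" "AE x in lborel. x \<in> S \<longrightarrow> f x = 0" "x \<in> S"
  shows "f x = 0"
proof (rule ccontr)
  assume "f x \<noteq> 0"
  let ?T = "S \<inter> f -` (- {0})"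
  have T: "open ?T"
    using assms by (intro continuous_open_preimage) auto
  moreover have "x \<in> ?T" using \<open>f x \<noteq> 0\<close> assms by auto
  moreover have "negligible ?T"
  proof -
    have "AE x in lborel. x \<notin> ?T" using assms(3) by eventually_elim auto
    then have "?T \<in> null_sets lborel"
      using T by (subst AE_iff_null_sets) auto
    then show ?thesis by (simp add: negligible_iff_null_sets null_sets_completionI)
  qed
  ultimately show False using open_not_negligible[of ?T] by blast
qed

text \<open>Polarization: \<open>\<integral> (\<rho>\<^sup>2 - |x|\<^sup>2)\<^sub>+\<^sup>2 f (y + e\<^sup>t x) f (y + e\<^sup>-\<^sup>t x)\<close> does not depend on \<open>t\<close>.  It
  vanishes as soon as \<open>e\<^sup>-\<^sup>t \<rho> \<le> r\<close>, hence also at \<open>t = 0\<close>, where the integrand is a weighted square.\<close>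

lemma harmonic_zero_ball_step:
  fixes f :: "'a::euclidean_space \<Rightarrow> real"
  assumes f: "harmonic_on (ball y R) f" and f0: "\<And>x. x \<in> ball y r \<Longrightarrow> f x = 0"
    and r: "0 < r" "r \<le> \<rho>" "\<rho>\<^sup>2 < r * R" and x: "x \<in> ball y \<rho>"
  shows "f x = 0"
proof -
  have "0 < \<rho>" using r by linarith
  have C2: "C_k_on 2 (ball y R) f" using f by (simp add: harmonic_on_def)
  note D = C2_onD[OF C2]
  have "\<rho> < r * R / \<rho>" using r \<open>0 < \<rho>\<close> by (simp add: field_simps power2_eq_square)
  then obtain \<rho>' where \<rho>': "\<rho> < \<rho>'" "\<rho>' < r * R / \<rho>" using dense by blast
  have "0 < \<rho>'" using \<rho>' \<open>0 < \<rho>\<close> by linarith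
  \<comment> \<open>For |t| < \<tau>, \<open>exp t\<close> maps \<open>ball 0 \<rho>'\<close> into
    \<open>ball 0 R\<close>. The upper bound on \<open>\<rho>'\<close> amounts to
    \<open>\<rho> / r < R / \<rho>'\<close>, which will place ln (\<rho> / r) below \<tau>; the
    lower bound leaves a margin around the support of the weight.\<close>
  define \<tau> where "\<tau> = ln (R / \<rho>')"
  have quot: "\<rho> / r < R / \<rho>'"
    using \<rho>' r \<open>0 < \<rho>\<close> \<open>0 < \<rho>'\<close> by (simp add: field_simps)
  have "1 \<le> \<rho> / r" using r by simp
  then have "1 < R / \<rho>'" using quot by linarith
  then have exp_tau: "exp \<tau> = R / \<rho>'" and "0 < \<tau>" by (auto simp: \<tau>_def)
  let ?U = "{-\<tau><..<\<tau>}"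
  let ?B = "ball (0::'a) \<rho>'"
  have inR: "y + exp t *\<^sub>R x \<in> ball y R" if "t \<in> ?U" "x \<in> ?B" for t x
  proof -
    have "exp t * norm x \<le> exp \<tau> * norm x" using that by (intro mult_right_mono) auto
    also have "\<dots> < exp \<tau> * \<rho>'" using that by (intro mult_strict_left_mono) auto
    also have "\<dots> = R" using \<open>0 < \<rho>'\<close> by (simp add: exp_tau)
    finally show ?thesis by (simp add: dist_norm)
  qed
  let ?m = "\<lambda>x::'a. (max 0 (\<rho>\<^sup>2 - (norm x)\<^sup>2))\<^sup>2"
  define u where "u t x = f (y + exp t *\<^sub>R x)" for t x
  \<comment> \<open>Dilation moves points radially, so the t-derivative of \<open>u t x\<close> is
    also the derivative x . grad (\<open>u t\<close>). This matches the radial gradient in the Green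
    identity.\<close>
  define G where "G t x = (\<Sum>b\<in>Basis. (x \<bullet> b) * (exp t * partial b f (y + exp t *\<^sub>R x)))" for t x
  define F where "F t x = ?m x * (u t x * u (- t) x)" for t x
  define F' where "F' t x = ?m x * (u (- t) x * G t x - u t x * G (- t) x)" for t x
  have m0: "?m x = 0" if "\<rho> \<le> norm x" for x
    using power_mono[OF that, of 2] \<open>0 < \<rho>\<close> by auto
  have der_u: "((\<lambda>t. u t x) has_real_derivative G t x) (at t)" if "t \<in> ?U" "x \<in> ?B" for t x
  proof -
    note df = D(1)[OF inR[OF that]]
    have "((\<lambda>t. f (y + exp t *\<^sub>R x)) has_derivative (\<lambda>h. partial ((h * exp t) *\<^sub>R x) f (y + exp t *\<^sub>R x))) (at t)"
      by (rule has_derivative_compose[of "\<lambda>t. y + exp t *\<^sub>R x" "\<lambda>h. (h * exp t) *\<^sub>R x",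
            OF _ has_derivative_partial[OF df]], rule has_derivative_eq_rhs, (rule derivative_intros)+) (auto simp: mult_ac)
    moreover have "partial ((h * exp t) *\<^sub>R x) f (y + exp t *\<^sub>R x) = G t x * h" for h
      by (subst partial_eq_sum_Basis[OF df]) (simp add: G_def sum_distrib_left mult_ac)
    ultimately show ?thesis
      by (simp add: has_field_derivative_def u_def mult_commute_abs)
  qed
  have cont_u: "continuous_on (?U \<times> ?B) (\<lambda>(t, x). u t x)"
    unfolding u_def split_beta
    by (rule continuous_on_compose2[OF D(4)]) (use inR in \<open>auto intro!: continuous_intros\<close>)
  have cont_G: "continuous_on (?U \<times> ?B) (\<lambda>(t, x). G t x)"
    unfolding G_def split_beta
    by (intro continuous_intros continuous_on_compose2[OF D(5)]) (use inR in auto)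
  have flip: "continuous_on (?U \<times> ?B) (\<lambda>(t, x). g (- t) x)"
    if "continuous_on (?U \<times> ?B) (\<lambda>(t, x). g t x)" for g :: "real \<Rightarrow> 'a \<Rightarrow> real"
  proof -
    have "continuous_on (?U \<times> ?B) (\<lambda>p. (\<lambda>(t, x). g t x) (- fst p, snd p))"
      by (rule continuous_on_compose2[OF that]) (auto intro!: continuous_intros)
    then show ?thesis by (simp add: split_beta)
  qed
  \<comment> \<open>The weight vanishes off \<open>cball 0 \<rho>\<close>, which lies inside
    \<open>?B\<close>; this absorbs whatever f does outside its domain.\<close>
  have ext: "continuous_on (?U \<times> UNIV) (\<lambda>(t, x). ?m x * g t x)"
    if "continuous_on (?U \<times> ?B) (\<lambda>(t, x). g t x)" for g :: "real \<Rightarrow> 'a \<Rightarrow> real"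
  proof -
    have "continuous_on (?U \<times> ?B \<union> ?U \<times> (- cball 0 \<rho>)) (\<lambda>(t, x). ?m x * g t x)"
    proof (rule continuous_on_open_Un)
      show "continuous_on (?U \<times> ?B) (\<lambda>(t, x). ?m x * g t x)"
        using that unfolding split_beta by (intro continuous_intros)
      show "continuous_on (?U \<times> (- cball 0 \<rho>)) (\<lambda>(t, x). ?m x * g t x)"
        by (rule continuous_on_eq[OF continuous_on_const[of _ 0]]) (use m0 in auto)
    qed (auto intro!: open_Times)
    also have "?U \<times> ?B \<union> ?U \<times> (- cball 0 \<rho>) = ?U \<times> UNIV"
      using \<rho>' by auto
    finally show ?thesis .
  qed
  have cont_F: "continuous_on (?U \<times> UNIV) (\<lambda>(t, x). F t x)"
    unfolding F_def using cont_u flip[OF cont_u]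
    by (intro ext) (auto simp: split_beta intro!: continuous_intros)
  have cont_F': "continuous_on (?U \<times> UNIV) (\<lambda>(t, x). F' t x)"
    unfolding F'_def using cont_u flip[OF cont_u] cont_G flip[OF cont_G]
    by (intro ext) (auto simp: split_beta intro!: continuous_intros)
  have cont_Ft: "continuous_on UNIV (F t)" if "t \<in> ?U" for t
  proof -
    have "continuous_on UNIV (\<lambda>x. (\<lambda>(t, x). F t x) (t, x))"
      by (rule continuous_on_compose2[OF cont_F]) (use that in \<open>auto intro!: continuous_intros\<close>)
    then show ?thesis by simp
  qed
  obtain c where "cball (0::'a) \<rho> \<subseteq> cbox (- c) c"
    using bounded_subset_cbox_symmetric[of "cball 0 \<rho>"] by auto
  then have m0': "?m x = 0" if "x \<notin> cbox (- c) c" for x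
    using m0[of x] that by (meson in_mono linear mem_cball_0)
  have der_F: "((\<lambda>t. F t x) has_real_derivative F' t x) (at t)" if t: "t \<in> ?U" for t x
  proof (cases "x \<in> ?B")
    case True
    have "((\<lambda>t. u (- t) x) has_real_derivative G (- t) x * - 1) (at t)"
      by (rule DERIV_chain2[OF der_u]) (use t True in \<open>auto intro!: derivative_eq_intros\<close>)
    then show ?thesis
      unfolding F_def F'_def
      by (auto intro!: derivative_eq_intros der_u[OF t True] simp: algebra_simps)
  next
    case False
    then show ?thesis using m0[of x] \<rho>' by (auto simp: F_def F'_def)
  qed
  \<comment> \<open>This is the radial Green identity for the two harmonic dilates
    \<open>u t\<close> and \<open>u (- t)\<close>.\<close>
  have int_F': "(\<integral>x. F' t x \<partial>lborel) = 0" if t: "t \<in> ?U" for t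
  proof -
    have "harmonic_on ?B (u s)" if "s \<in> ?U" for s
      unfolding u_def by (rule harmonic_on_affine[OF _ f]) (use inR[OF that] in auto)
    from this[of t] this[of "- t"] t
    have "(\<integral>x. ?m x * (\<Sum>b\<in>Basis. (x \<bullet> b) *
        (u (- t) x * partial b (u t) x - u t x * partial b (u (- t)) x)) \<partial>lborel) = 0"
      using \<open>0 < \<rho>\<close> \<rho>' by (intro integral_radial_Green_eq_0[of \<rho>']) auto
    also have "(\<lambda>x. ?m x * (\<Sum>b\<in>Basis. (x \<bullet> b) *
        (u (- t) x * partial b (u t) x - u t x * partial b (u (- t)) x))) = F' t"
    proof
      fix x :: 'a
      show "?m x * (\<Sum>b\<in>Basis. (x \<bullet> b) *
        (u (- t) x * partial b (u t) x - u t x * partial b (u (- t)) x)) = F' t x"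
      proof (cases "x \<in> ?B")
        case True
        have "partial b (u s) x = exp s * partial b f (y + exp s *\<^sub>R x)" if "s \<in> ?U" for s b
          unfolding u_def by (rule partial_affine(2)[OF D(1)[OF inR[OF that True]]])
        from this[of t] this[of "- t"] t show ?thesis
          by (simp add: F'_def G_def right_diff_distrib sum_subtractf sum_distrib_left mult_ac)
      next
        case False
        then show ?thesis using m0[of x] \<rho>' by (auto simp: F'_def)
      qed
    qed
    finally show ?thesis .
  qed
  have "\<exists>C. \<forall>t\<in>?U. (\<integral>x. F t x \<partial>lborel) = C"
  proof (rule has_field_derivative_zero_constant)
    fix t assume t: "t \<in> ?U"
    have "((\<lambda>t. \<integral>x. F t x \<partial>lborel) has_real_derivative (\<integral>x. F' t x \<partial>lborel)) (at t within ?U)"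
    proof (rule has_real_derivative_lborel_integral[OF _ cont_Ft cont_F' _ _ t])
      show "F t x = 0" "F' t x = 0" if "x \<notin> cbox (- c) c" for t x
        using m0'[OF that] by (auto simp: F_def F'_def)
    qed (auto intro: has_field_derivative_at_within[OF der_F])
    then show "((\<lambda>t. \<integral>x. F t x \<partial>lborel) has_real_derivative 0) (at t within ?U)"
      using int_F'[OF t] by simp
  qed auto
  then obtain C where C: "\<And>t. t \<in> ?U \<Longrightarrow> (\<integral>x. F t x \<partial>lborel) = C" by blast
  \<comment> \<open>At this time the contracted dilate evaluates f at y + (r / \<rho>) x, which lies
    in \<open>ball y r\<close> whenever |x| < \<rho>.\<close>
  let ?s = "ln (\<rho> / r)"
  have s: "exp ?s = \<rho> / r" using r \<open>0 < \<rho>\<close> by simp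
  have "?s \<in> ?U"
  proof -
    have "0 \<le> ?s" using \<open>1 \<le> \<rho> / r\<close> by (rule ln_ge_zero)
    moreover have "?s < \<tau>"
      using quot s exp_tau by (metis exp_less_cancel_iff)
    ultimately show ?thesis using \<open>0 < \<tau>\<close> by auto
  qed
  moreover have "F ?s x = 0" for x
  proof (cases "norm x < \<rho>")
    case True
    have "u (- ?s) x = f (y + (r / \<rho>) *\<^sub>R x)"
      unfolding u_def exp_minus s by (simp add: inverse_eq_divide)
    also have "\<dots> = 0"
      using True r \<open>0 < \<rho>\<close> by (intro f0) (simp add: dist_norm field_simps)
    finally show ?thesis by (simp add: F_def)
  qed (use m0 in \<open>auto simp: F_def\<close>)
  ultimately have "(\<integral>x. F 0 x \<partial>lborel) = 0"
    using C[of ?s] C[of 0] \<open>0 < \<tau>\<close> by simp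
  moreover have "F 0 x = ?m x * (f (y + x))\<^sup>2" for x
    by (simp add: F_def u_def power2_eq_square)
  moreover have "continuous_on UNIV (F 0)" using cont_Ft[of 0] \<open>0 < \<tau>\<close> by simp
  moreover have "integrable lborel (F 0)"
    using calculation(3) m0'
    by (intro lborel_integral_eq_cbox(1)[of "- c" c]) (auto simp: F_def intro: continuous_on_subset)
  ultimately have "AE x in lborel. F 0 x = 0"
    by (subst (asm) integral_nonneg_eq_0_iff_AE) auto
  then have "F 0 (x - y) = 0"
    using \<open>continuous_on UNIV (F 0)\<close> by (intro continuous_AE_eq_0[of UNIV "F 0"]) auto
  moreover have "(norm (x - y))\<^sup>2 < \<rho>\<^sup>2"
    using x by (intro power_strict_mono) (auto simp: dist_norm norm_minus_commute)
  ultimately show ?thesis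
    by (simp add: F_def u_def)
qed

text \<open>Let t be the supremum of the radii up to R on which f vanishes. If t < R, then t is
  smaller than the geometric mean sqrt (t R), and the polarization step reaches every radius in
  between, a contradiction.\<close>

lemma harmonic_zero_ball:
  fixes f :: "'a::euclidean_space \<Rightarrow> real"
  assumes f: "harmonic_on (ball y R) f" and f0: "\<And>x. x \<in> ball y r \<Longrightarrow> f x = 0"
    and "0 < r" and x: "x \<in> ball y R"
  shows "f x = 0"
proof (cases "r < R")
  case True
  define A where "A = {s. s \<le> R \<and> (\<forall>x\<in>ball y s. f x = 0)}"
  define t where "t = Sup A"
  have bdd: "bdd_above A" and rA: "r \<in> A"
    using True f0 by (auto simp: A_def intro!: bdd_aboveI[of _ R])
  have "r \<le> t" "t \<le> R"
    unfolding t_def using bdd rA by (auto intro!: cSup_upper cSup_least simp: A_def)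
  have t0: "f x = 0" if "x \<in> ball y t" for x
  proof -
    have "dist y x < Sup A" using that by (simp add: t_def)
    then obtain s where "s \<in> A" "dist y x < s" using less_cSup_iff[of A] bdd rA by blast
    then show ?thesis by (auto simp: A_def)
  qed
  have "\<not> t < R"
  proof
    assume "t < R"
    have "0 < t" using \<open>0 < r\<close> \<open>r \<le> t\<close> by linarith
    have "t = sqrt (t * t)" using \<open>0 < t\<close> by simp
    also have "\<dots> < sqrt (t * R)" using \<open>0 < t\<close> \<open>t < R\<close> by (intro real_sqrt_less_mono) auto
    finally obtain \<rho> where \<rho>: "t < \<rho>" "\<rho> < sqrt (t * R)" using dense by blast
    have "\<rho>\<^sup>2 < (sqrt (t * R))\<^sup>2" using \<rho> \<open>0 < t\<close> by (intro power_strict_mono) auto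
    then have sq: "\<rho>\<^sup>2 < t * R" using \<open>0 < t\<close> \<open>t < R\<close> by simp
    have "\<rho> \<in> A"
    proof -
      have "\<rho> * \<rho> < R * R"
      proof -
        have "t * R < R * R" using \<open>0 < t\<close> \<open>t < R\<close> by (intro mult_strict_right_mono) auto
        with sq show ?thesis by (simp add: power2_eq_square)
      qed
      then have "\<rho> \<le> R" using \<rho> \<open>0 < t\<close> \<open>t < R\<close> by (meson linear mult_mono not_le less_le_trans less_imp_le)
      then show ?thesis
        using harmonic_zero_ball_step[OF f t0 \<open>0 < t\<close> _ sq] \<rho> by (auto simp: A_def)
    qed
    then have "\<rho> \<le> t" unfolding t_def using bdd by (rule cSup_upper)
    with \<rho> show False by simp
  qed
  then show ?thesis using t0[of x] x \<open>t \<le> R\<close> by simp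
qed (use f0 x in auto)

text \<open>The interior \<open>Z\<close> of the zero set is open and contains
  \<open>\<omega>\<close>. The work is to show that \<open>\<Omega> - Z\<close> is open as well;
  connectedness then makes it empty.\<close>

lemma harmonic_unique_continuation:
  fixes f :: "'a::euclidean_space \<Rightarrow> real"
  assumes \<Omega>: "open \<Omega>" "connected \<Omega>" and f: "harmonic_on \<Omega> f"
    and \<omega>: "open \<omega>" "\<omega> \<noteq> {}" "\<omega> \<subseteq> \<Omega>" and f0: "\<And>x. x \<in> \<omega> \<Longrightarrow> f x = 0" and x: "x \<in> \<Omega>"
  shows "f x = 0"
proof -
  define Z where "Z = interior {x \<in> \<Omega>. f x = 0}"
  have "\<omega> \<subseteq> Z" unfolding Z_def using \<omega> f0 by (intro interior_maximal) auto
  have ZO: "Z \<subseteq> \<Omega>" unfolding Z_def using interior_subset by fastforce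
  have "open (\<Omega> - Z)"
  proof (rule openI)
    fix p assume p: "p \<in> \<Omega> - Z"
    then obtain e where e: "e > 0" "ball p e \<subseteq> \<Omega>"
      using \<Omega> by (meson DiffD1 openE)
    \<comment> \<open>Half the radius is taken so that a point y of \<open>Z\<close> within e / 2 of
      p has a ball of radius e / 2 that both stays in \<open>ball p e\<close> and contains
      p.\<close>
    have "ball p (e / 2) \<inter> Z = {}"
    proof (rule ccontr)
      assume "ball p (e / 2) \<inter> Z \<noteq> {}"
      then obtain y where y: "dist p y < e / 2" "y \<in> Z" by auto
      obtain r where r: "r > 0" "ball y r \<subseteq> Z"
        using y openE[OF open_interior, of y] unfolding Z_def by metis
      have sub: "ball y (e / 2) \<subseteq> ball p e"
      proof
        fix x assume "x \<in> ball y (e / 2)"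
        then show "x \<in> ball p e" using y dist_triangle[of p x y] by simp
      qed
      have "harmonic_on (ball y (e / 2)) f"
        using harmonic_on_affine[OF \<Omega>(1) f, of "ball y (e / 2)" 0 1] subset_trans[OF sub e(2)] by simp
      moreover have "f x = 0" if "x \<in> ball y r" for x
        using that r interior_subset unfolding Z_def by blast
      ultimately have "f x = 0" if "x \<in> ball y (e / 2)" for x
        using harmonic_zero_ball r(1) that by blast
      then have "ball y (e / 2) \<subseteq> Z"
        unfolding Z_def using sub e by (intro interior_maximal) auto
      moreover have "p \<in> ball y (e / 2)" using y by (simp add: dist_commute)
      ultimately show False using p by auto
    qed
    moreover have "ball p (e / 2) \<subseteq> \<Omega>"
      using e subset_ball[of "e / 2" e p] by auto
    ultimately show "\<exists>e>0. ball p e \<subseteq> \<Omega> - Z"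
      using e by (intro exI[of _ "e / 2"]) auto
  qed
  then have "\<Omega> - Z = {}"
    using connectedD[OF \<Omega>(2), of Z "\<Omega> - Z"] \<open>\<omega> \<subseteq> Z\<close> \<omega> ZO by (auto simp: Z_def)
  then show ?thesis using x interior_subset unfolding Z_def by blast
qed

subsection \<open>Test functions on boxes\<close>

lemma C_k_on_Suc_imp: "C_k_on (Suc k) S f \<Longrightarrow> C_k_on k S f"
proof (induction k arbitrary: f)
  case 0
  then show ?case
    by (auto intro!: continuous_at_imp_continuous_on differentiable_imp_continuous_within)
next
  case (Suc k)
  then show ?case using C_k_on.simps(2) by blast
qed

lemma C_k_on_const: "C_k_on k S (\<lambda>_. c)"
proof (induction k arbitrary: c)
  case (Suc k)
  have "partial b (\<lambda>_. c) = (\<lambda>_. 0)" for b :: 'a by (rule ext) (rule partial_const)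
  with Suc show ?case by simp
qed simp

lemma C_k_on_add:
  "C_k_on k UNIV f \<Longrightarrow> C_k_on k UNIV g \<Longrightarrow> C_k_on k UNIV (\<lambda>x. f x + g x)"
proof (induction k arbitrary: f g)
  case (Suc k)
  then have "partial b (\<lambda>x. f x + g x) = (\<lambda>x. partial b f x + partial b g x)" for b
    by (intro ext partial_add) auto
  with Suc show ?case by (simp add: differentiable_add)
qed (auto intro: continuous_on_add)

lemma C_k_on_mult:
  "C_k_on k UNIV f \<Longrightarrow> C_k_on k UNIV g \<Longrightarrow> C_k_on k UNIV (\<lambda>x. f x * g x)"
proof (induction k arbitrary: f g)
  case (Suc k)
  have "partial b (\<lambda>x. f x * g x) = (\<lambda>x. f x * partial b g x + partial b f x * g x)" for b
    using Suc.prems by (intro ext partial_mult) auto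
  moreover have "C_k_on k UNIV f" "C_k_on k UNIV g"
    using Suc.prems by (auto intro: C_k_on_Suc_imp)
  ultimately show ?case using Suc by (simp add: differentiable_mult C_k_on_add)
qed (auto intro: continuous_on_mult)

lemma C_k_on_prod:
  assumes "finite A" "\<And>i. i \<in> A \<Longrightarrow> C_k_on k UNIV (f i)"
  shows "C_k_on k UNIV (\<lambda>x. \<Prod>i\<in>A. f i x)"
  using assms by induction (auto intro: C_k_on_const C_k_on_mult)

text \<open>Taking the whole sequence of successive derivatives as \<open>h\<close> closes the
  induction: the chain rule turns \<open>h i\<close> into \<open>h (Suc i)\<close>.\<close>

lemma C_k_on_compose:
  assumes "\<And>i t. (h i has_real_derivative h (Suc i) t) (at t)" and "\<And>k. C_k_on k UNIV p"
  shows "C_k_on k UNIV (\<lambda>x. h i (p x))"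
proof (induction k arbitrary: i)
  case 0
  have "continuous_on UNIV (h i)"
    using assms(1) by (intro continuous_at_imp_continuous_on ballI DERIV_isCont)
  moreover have "continuous_on UNIV p" using assms(2)[of 0] by simp
  ultimately show ?case by (auto intro: continuous_on_compose2)
next
  case (Suc k)
  have p: "p differentiable (at x)" for x using assms(2)[of 1] by simp
  have d: "((\<lambda>x. h i (p x)) has_derivative (\<lambda>v. h (Suc i) (p x) * partial v p x)) (at x)" for x
    by (rule has_derivative_compose[OF has_derivative_partial[OF p]
          assms(1)[unfolded has_field_derivative_def]])
  have "partial b (\<lambda>x. h i (p x)) = (\<lambda>x. h (Suc i) (p x) * partial b p x)" for b
    by (rule ext) (rule partial_has_derivative[OF d])
  moreover have "C_k_on k UNIV (partial b p)" if "b \<in> Basis" for b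
    using assms(2)[of "Suc k"] that by simp
  ultimately show ?case using d Suc by (auto simp: differentiable_def intro!: C_k_on_mult)
qed

lemma C_k_on_affine: "C_k_on k UNIV (\<lambda>x. c * (x \<bullet> d) + e)"
proof (cases k)
  case (Suc j)
  have D: "((\<lambda>x. c * (x \<bullet> d) + e) has_derivative (\<lambda>v. c * (v \<bullet> d))) (at x)" for x
    by (auto intro!: derivative_eq_intros)
  have "partial b (\<lambda>x. c * (x \<bullet> d) + e) = (\<lambda>_. c * (b \<bullet> d))" for b
    by (rule ext) (rule partial_has_derivative[OF D])
  then show ?thesis using D by (auto simp: Suc differentiable_def C_k_on_const)
qed (auto intro!: continuous_intros)

text \<open>With s = 1 / t the recursion is the rule d/dt (p(s) exp(-s)) = s^2 (p(s) - p'(s))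
  exp(-s).\<close>

primrec flat_poly :: "nat \<Rightarrow> real poly" where
  "flat_poly 0 = 1"
| "flat_poly (Suc i) = [:0, 0, 1:] * (flat_poly i - pderiv (flat_poly i))"

text \<open>\<open>flat i\<close> is the \<open>i\<close>-th derivative of the function \<open>exp (- 1 / t)\<close>, extended by 0 to \<open>t \<le> 0\<close>.\<close>

definition flat :: "nat \<Rightarrow> real \<Rightarrow> real" where
  "flat i t = (if 0 < t then poly (flat_poly i) (1 / t) * exp (- (1 / t)) else 0)"

lemma poly_times_exp_minus_tendsto_0:
  fixes p :: "real poly"
  shows "((\<lambda>s. poly p s * exp (- s)) \<longlongrightarrow> 0) at_top"
proof -
  have "((\<lambda>s. \<Sum>i\<le>degree p. coeff p i * (s ^ i / exp s)) \<longlongrightarrow> (\<Sum>i\<le>degree p. coeff p i * 0)) at_top"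
    by (intro tendsto_intros tendsto_power_div_exp_0)
  moreover have "(\<lambda>s. \<Sum>i\<le>degree p. coeff p i * (s ^ i / exp s)) = (\<lambda>s. poly p s * exp (- s))"
    by (simp add: poly_altdef exp_minus sum_distrib_right divide_inverse mult.assoc)
  ultimately show ?thesis by simp
qed

lemma DERIV_flat: "(flat i has_real_derivative flat (Suc i) t) (at t)"
proof -
  consider "t < 0" | "t > 0" | "t = 0" by linarith
  then show ?thesis
  proof cases
    case 1
    have "(flat i has_real_derivative 0) (at t)"
      by (rule has_field_derivative_transform_within_open[OF DERIV_const[of 0], of "{..<0}"])
         (use 1 in \<open>auto simp: flat_def\<close>)
    with 1 show ?thesis by (simp add: flat_def)
  next
    case 2
    have "((\<lambda>t. poly (flat_poly i) (1 / t) * exp (- (1 / t))) has_real_derivative flat (Suc i) t) (at t)"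
      using 2
      by (auto intro!: derivative_eq_intros DERIV_chain2[OF poly_DERIV]
          simp: flat_def field_simps power2_eq_square)
    then show ?thesis
      by (rule has_field_derivative_transform_within_open[of _ _ _ "{0<..}"])
         (use 2 in \<open>auto simp: flat_def\<close>)
  next
    case 3
    \<comment> \<open>\<open>pCons 0\<close> multiplies the polynomial by s = 1 / h, which is the
      division by h in the difference quotient at 0.\<close>
    have lim: "((\<lambda>t. poly (pCons 0 (flat_poly i)) (inverse t) * exp (- inverse t)) \<longlongrightarrow> 0) (at_right 0)"
      by (rule filterlim_compose[OF poly_times_exp_minus_tendsto_0 filterlim_inverse_at_top_right])
    have "((\<lambda>h. flat i h / h) \<longlongrightarrow> 0) (at 0)"
    proof (rule filterlim_split_at)
      show "((\<lambda>h. flat i h / h) \<longlongrightarrow> 0) (at_left 0)"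
        by (rule tendsto_eventually)
           (auto simp: eventually_at_filter flat_def)
      show "((\<lambda>h. flat i h / h) \<longlongrightarrow> 0) (at_right 0)"
        by (rule Lim_transform_eventually[OF lim])
           (auto simp: eventually_at_filter flat_def field_simps)
    qed
    with 3 show ?thesis by (simp add: DERIV_def flat_def)
  qed
qed

lemma flat_0: "flat 0 t = (if 0 < t then exp (- (1 / t)) else 0)"
  by (simp add: flat_def)

lemma flat_0_scaled_tendsto:
  assumes "0 < t"
  shows "(\<lambda>n. flat 0 (real (Suc n) * t)) \<longlonglongrightarrow> 1"
proof -
  have "(\<lambda>n. exp (- (inverse (real (Suc n)) * inverse t))) \<longlonglongrightarrow> exp (- (0 * inverse t))"
    by (intro tendsto_intros LIMSEQ_inverse_real_of_nat)
  moreover have "flat 0 (real (Suc n) * t) = exp (- (inverse (real (Suc n)) * inverse t))" for n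
    using assms by (simp add: flat_0 field_simps add_pos_nonneg)
  ultimately show ?thesis by simp
qed

text \<open>The scale \<open>s\<close> steepens the walls while the support stays in
  \<open>cbox a c\<close>; hence the bumps can tend to the indicator of the box and remain test
  functions.\<close>

definition box_bump :: "'a::euclidean_space \<Rightarrow> 'a \<Rightarrow> real \<Rightarrow> 'a \<Rightarrow> real" where
  "box_bump a c s x = (\<Prod>b\<in>Basis. flat 0 (s * (x \<bullet> b - a \<bullet> b)) * flat 0 (s * (c \<bullet> b - x \<bullet> b)))"

lemma box_bump_bounds: "0 \<le> box_bump a c s x" "box_bump a c s x \<le> 1"
proof -
  have "0 \<le> flat 0 t" "flat 0 t \<le> 1" for t by (auto simp: flat_0)
  then show "0 \<le> box_bump a c s x" "box_bump a c s x \<le> 1"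
    unfolding box_bump_def by (auto intro!: prod_nonneg prod_le_1 mult_le_one)
qed

lemma box_bump_eq_0: "0 < s \<Longrightarrow> x \<notin> box a c \<Longrightarrow> box_bump a c s x = 0"
  unfolding box_bump_def mem_box
  by (rule prod_zero[OF finite_Basis]) (auto simp: flat_0 zero_less_mult_iff Bex_def)

lemma box_bump_tendsto:
  fixes a c x :: "'a::euclidean_space"
  shows "(\<lambda>n. box_bump a c (real (Suc n)) x) \<longlonglongrightarrow> indicator (box a c) x"
proof (cases "x \<in> box a c")
  case True
  have "(\<lambda>n. box_bump a c (real (Suc n)) x) \<longlonglongrightarrow> (\<Prod>b\<in>(Basis :: 'a set). 1 * 1)"
    unfolding box_bump_def using True
    by (intro tendsto_prod tendsto_mult flat_0_scaled_tendsto) (auto simp: mem_box)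
  with True show ?thesis by simp
next
  case False
  then have "box_bump a c (real (Suc n)) x = 0" for n by (intro box_bump_eq_0) auto
  with False show ?thesis by simp
qed

lemma box_bump_test_function:
  assumes "0 < s" "cbox a c \<subseteq> \<Omega>"
  shows "box_bump a c s \<in> test_functions \<Omega>"
proof -
  have "C_k_on k UNIV (\<lambda>x::'a. flat 0 (t * (x \<bullet> b) + e))" for k b t e
    by (rule C_k_on_compose[of flat, OF DERIV_flat C_k_on_affine])
  from this[of _ s _ "- (s * (a \<bullet> _))"] this[of _ "- s" _ "s * (c \<bullet> _)"]
  have "C_k_on k UNIV (\<lambda>x. flat 0 (s * (x \<bullet> b - a \<bullet> b)) * flat 0 (s * (c \<bullet> b - x \<bullet> b)))" for k b
    by (intro C_k_on_mult) (simp_all add: algebra_simps)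
  then have "C_k_on k UNIV (box_bump a c s)" for k
    unfolding box_bump_def[abs_def] by (intro C_k_on_prod) auto
  moreover have "box_bump a c s x = 0" if "x \<notin> cbox a c" for x
    using that box_subset_cbox by (intro box_bump_eq_0 assms(1)) auto
  ultimately show ?thesis
    unfolding test_functions_def using assms(2) by (auto intro!: exI[of _ "cbox a c"])
qed

section \<open>Functions that integrate to 0 on boxes or against test functions\<close>

lemma AE_eq_0_on_box:
  fixes g :: "'a::euclidean_space \<Rightarrow> real"
  assumes int: "set_integrable lborel (box a c) g"
    and zero: "\<And>a' c'. box a' c' \<subseteq> box a c \<Longrightarrow> (LINT x:box a' c'|lborel. g x) = 0"
  shows "AE x in lborel. x \<in> box a c \<longrightarrow> g x = 0"
proof -
  let ?B = "box a c"
  have int': "set_integrable lborel S g" if "S \<in> sets borel" "S \<subseteq> ?B" for S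
    by (rule set_integrable_subset[OF int]) (use that in auto)
  have borel: "sets borel = sigma_sets UNIV (range (\<lambda>(a, b). box a b :: 'a set))"
    by (subst borel_eq_box) (simp add: sets_measure_of)
  \<comment> \<open>Boxes are stable under intersection and generate the Borel sets, so the
    vanishing of the integrals spreads by Dynkin induction. Intersecting with \<open>?B\<close>
    keeps all integrals finite.\<close>
  have zero_borel: "(LINT x:?B \<inter> S|lborel. g x) = 0" if "S \<in> sets borel" for S
  proof -
    have "Int_stable (range (\<lambda>(a, b). box a b :: 'a set))"
      by (auto simp: Int_stable_def box_Int_box)
    moreover have "range (\<lambda>(a, b). box a b :: 'a set) \<subseteq> Pow UNIV" by simp
    moreover note that[unfolded borel]
    ultimately show ?thesis
    proof (induction rule: sigma_sets_induct_disjoint)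
      case (basic A)
      then show ?case by (auto simp: box_Int_box intro!: zero) (auto simp: box_Int_box[symmetric])
    next
      case (compl A)
      then have A: "A \<in> sets borel" by (simp add: borel)
      have "(LINT x:?B|lborel. g x) = (LINT x:(?B \<inter> A) \<union> (?B \<inter> (UNIV - A))|lborel. g x)"
        by (rule arg_cong[where f="\<lambda>S. set_lebesgue_integral lborel S g"]) auto
      also have "\<dots> = (LINT x:?B \<inter> A|lborel. g x) + (LINT x:?B \<inter> (UNIV - A)|lborel. g x)"
        using A by (intro set_integral_Un int') auto
      finally show ?case using compl zero[of a c] by simp
    next
      case (union A)
      then have A: "A i \<in> sets borel" for i by (auto simp: borel)
      have "(LINT x:?B \<inter> \<Union> (range A)|lborel. g x) = (LINT x:(\<Union>i. ?B \<inter> A i)|lborel. g x)"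
        by simp
      also have "\<dots> = (\<Sum>i. LINT x:?B \<inter> A i|lborel. g x)"
        using A union by (intro lebesgue_integral_countable_add int') (auto simp: disjoint_family_on_def)
      finally show ?case using union by simp
    qed (auto simp: set_lebesgue_integral_def)
  qed
  have meas: "(\<lambda>x. indicator ?B x *\<^sub>R g x) \<in> borel_measurable borel"
    using int by (simp add: set_integrable_def)
  have part: "AE x in lborel. indicator (?B \<inter> S) x * g x = 0"
    if S: "S \<in> sets borel" "(\<forall>x\<in>?B \<inter> S. 0 \<le> g x) \<or> (\<forall>x\<in>?B \<inter> S. g x \<le> 0)" for S
  proof -
    have i: "integrable lborel (\<lambda>x. indicator (?B \<inter> S) x * g x)"
      using int'[of "?B \<inter> S"] S by (simp add: set_integrable_def)
    have z: "(\<integral>x. indicator (?B \<inter> S) x * g x \<partial>lborel) = 0"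
      using zero_borel[OF S(1)] by (simp add: set_lebesgue_integral_def)
    from S(2) show ?thesis
    proof
      assume "\<forall>x\<in>?B \<inter> S. 0 \<le> g x"
      then show ?thesis
        using integral_nonneg_eq_0_iff_AE[OF i] z by (auto simp: indicator_def)
    next
      assume "\<forall>x\<in>?B \<inter> S. g x \<le> 0"
      then have "AE x in lborel. - (indicator (?B \<inter> S) x * g x) = 0"
        using integral_nonneg_eq_0_iff_AE[OF integrable_minus[OF i]] z by (auto simp: indicator_def)
      then show ?thesis by simp
    qed
  qed
  \<comment> \<open>These are the sets where g is positive or negative within the box. The indicator
    is included since g is known to be measurable only after multiplication by it.\<close>
  let ?S = "{x. 0 < indicator ?B x *\<^sub>R g x}" and ?T = "{x. indicator ?B x *\<^sub>R g x < 0}"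
  have "?S \<in> sets borel" "?T \<in> sets borel"
    using meas by (simp_all add: borel_measurable_less)
  then have "AE x in lborel. indicator (?B \<inter> ?S) x * g x = 0" "AE x in lborel. indicator (?B \<inter> ?T) x * g x = 0"
    by (intro part; force simp: indicator_def split: if_splits)+
  then show ?thesis
    by eventually_elim (auto simp: indicator_def split: if_splits)
qed

text \<open>A bounded set has finite measure, so its indicator is itself square integrable and the
  product with g is integrable.\<close>

lemma set_integrable_sq_integrable:
  assumes "sq_integrable g" "S \<in> sets borel" "bounded S"
  shows "set_integrable lborel S g"
proof -
  have "sq_integrable (indicator S)"
    using assms(2) emeasure_bounded_finite[OF assms(3)]
    by (auto simp: sq_integrable_def power2_eq_square indicator_inter_arith[symmetric]
        intro!: integrable_real_indicator)
  from sq_integrable_mult[OF this assms(1)] show ?thesis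
    by (simp add: set_integrable_def)
qed

text \<open>The fundamental lemma of the calculus of variations. Bumps tend to the indicators of
  boxes, dominated by |g| on the box; and \<open>\<Omega>\<close> is a countable union of closed
  boxes, whose faces are null sets.\<close>

lemma AE_eq_0_if_test_functions:
  fixes g :: "'a::euclidean_space \<Rightarrow> real"
  assumes \<Omega>: "open \<Omega>" and g: "sq_integrable g"
    and zero: "\<And>\<phi>. \<phi> \<in> test_functions \<Omega> \<Longrightarrow> (\<integral>x. g x * \<phi> x \<partial>lborel) = 0"
  shows "AE x in lborel. x \<in> \<Omega> \<longrightarrow> g x = 0"
proof -
  have [measurable]: "g \<in> borel_measurable lborel" using g by (simp add: sq_integrable_def)
  have box0: "(LINT x:box a c|lborel. g x) = 0" if sub: "cbox a c \<subseteq> \<Omega>" for a c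
  proof -
    have t: "box_bump a c (real (Suc n)) \<in> test_functions \<Omega>" for n
      using sub by (intro box_bump_test_function) auto
    have [measurable]: "box_bump a c (real (Suc n)) \<in> borel_measurable lborel" for n
      using t[of n] unfolding test_functions_def
      by (auto intro!: borel_measurable_continuous_onI dest: spec[of _ 0])
    have "(\<lambda>n. \<integral>x. g x * box_bump a c (real (Suc n)) x \<partial>lborel) \<longlonglongrightarrow> (\<integral>x. g x * indicator (box a c) x \<partial>lborel)"
    proof (rule integral_dominated_convergence)
      show "integrable lborel (\<lambda>x. \<bar>indicator (box a c) x *\<^sub>R g x\<bar>)"
        using set_integrable_sq_integrable[OF g, of "box a c"] by (simp add: set_integrable_def)
      show "AE x in lborel. (\<lambda>n. g x * box_bump a c (real (Suc n)) x) \<longlonglongrightarrow> g x * indicator (box a c) x"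
        by (intro AE_I2 tendsto_intros box_bump_tendsto)
      show "AE x in lborel. norm (g x * box_bump a c (real (Suc n)) x) \<le> \<bar>indicator (box a c) x *\<^sub>R g x\<bar>" for n
        using box_bump_bounds[of a c "real (Suc n)"] box_bump_eq_0[of "real (Suc n)" _ a c]
        by (intro AE_I2) (auto simp: abs_mult indicator_def intro!: mult_left_le)
      show "(\<lambda>x. g x * box_bump a c (real (Suc n)) x) \<in> borel_measurable lborel" for n
        by measurable
    qed auto
    then have "(\<integral>x. g x * indicator (box a c) x \<partial>lborel) = 0"
      using zero[OF t] by (simp add: LIMSEQ_const_iff)
    then show ?thesis by (simp add: set_lebesgue_integral_def mult.commute)
  qed
  obtain D where D: "countable D" "D \<subseteq> Pow \<Omega>" "\<And>X. X \<in> D \<Longrightarrow> \<exists>a b. X = cbox a b" "\<Union>D = \<Omega>"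
    using open_countable_Union_open_cbox[OF \<Omega>] by metis
  have "AE x in lborel. x \<in> X \<longrightarrow> g x = 0" if "X \<in> D" for X
  proof -
    obtain a c where X: "X = cbox a c" using D(3)[OF \<open>X \<in> D\<close>] by auto
    then have sub: "cbox a c \<subseteq> \<Omega>" using D(2) \<open>X \<in> D\<close> by auto
    have "AE x in lborel. x \<in> box a c \<longrightarrow> g x = 0"
    proof (rule AE_eq_0_on_box)
      show "set_integrable lborel (box a c) g"
        using g by (intro set_integrable_sq_integrable) auto
      show "(LINT x:box a' c'|lborel. g x) = 0" if "box a' c' \<subseteq> box a c" for a' c'
      \<comment> \<open>A nonempty open box has the closed box as its closure, so
        \<open>cbox a' c'\<close> stays in \<open>\<Omega>\<close>. An empty
        \<open>box a' c'\<close> says nothing about where \<open>cbox a' c'\<close> lies.\<close>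
      proof (cases "box a' c' = {}")
        case False
        then have "cbox a' c' \<subseteq> cbox a c"
          using that closure_mono[OF that] closure_box[of a' c']
            closure_minimal[OF box_subset_cbox closed_cbox, of a c] by auto
        then show ?thesis using sub by (intro box0) auto
      qed (simp add: set_lebesgue_integral_def)
    qed
    moreover have "AE x in lborel. x \<notin> cbox a c - box a c"
    proof -
      have "cbox a c - box a c \<in> null_sets lborel"
        using negligible_frontier_interval[of a c]
        by (subst null_sets_completion_iff[symmetric]) (auto simp: negligible_iff_null_sets)
      then show ?thesis by (rule AE_not_in)
    qed
    ultimately show ?thesis unfolding X by eventually_elim auto
  qed
  then have "AE x in lborel. \<forall>X\<in>D. x \<in> X \<longrightarrow> g x = 0"
    using D(1) by (subst AE_ball_countable) auto
  then show ?thesis by eventually_elim (use D(4) in auto)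
qed

subsection \<open>Weak derivatives\<close>

lemma sq_integrable_rep_l2: "sq_integrable (rep_l2 f)"
  using Quotient3_rep_reflp[OF Quotient3_l2, of f] by (simp add: l2_eq_def)

lemma AE_rep_abs_l2: "sq_integrable f \<Longrightarrow> AE x in lborel. rep_l2 (abs_l2 f) x = f x"
  using rep_abs_rsp_left[OF Quotient3_l2, of f f] by (auto simp: l2_eq_def)

lemma l2_eqI:
  assumes "AE x in lborel. rep_l2 f x = rep_l2 g x"
  shows "f = g"
proof -
  have "l2_eq (rep_l2 f) (rep_l2 g)"
    using assms by (simp add: l2_eq_def sq_integrable_rep_l2)
  then show ?thesis using Quotient3_rel_rep[OF Quotient3_l2] by blast
qed

lemma AE_rep_l2_diff: "AE x in lborel. rep_l2 (f - g) x = rep_l2 f x - rep_l2 g x"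
  unfolding minus_l2_def by (simp add: AE_rep_abs_l2 sq_integrable_diff sq_integrable_rep_l2)

lemma AE_rep_l2_zero: "AE x in lborel. rep_l2 0 x = 0"
  unfolding zero_l2_def by (simp add: AE_rep_abs_l2 sq_integrable_zero)

lemma AE_rep_l2_restr:
  assumes "S \<in> sets borel"
  shows "AE x in lborel. rep_l2 (restr S f) x = indicator S x * rep_l2 f x"
  using assms unfolding restr_def
  by (simp add: AE_rep_abs_l2 sq_integrable_indicator_mult sq_integrable_rep_l2)

lemma integral_rep_l2_mult:
  assumes "sq_integrable \<psi>"
  shows "(\<integral>x. rep_l2 f x * \<psi> x \<partial>lborel) = f \<bullet> abs_l2 \<psi>"
proof -
  have m: "rep_l2 f \<in> borel_measurable lborel" "\<psi> \<in> borel_measurable lborel"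
    "rep_l2 (abs_l2 \<psi>) \<in> borel_measurable lborel"
    using assms sq_integrable_rep_l2 by (auto simp: sq_integrable_def)
  have "f \<bullet> abs_l2 \<psi> = (\<integral>x. rep_l2 f x * rep_l2 (abs_l2 \<psi>) x \<partial>lborel)"
    by (simp add: inner_l2_def)
  also have "\<dots> = (\<integral>x. rep_l2 f x * \<psi> x \<partial>lborel)"
    using m AE_rep_abs_l2[OF assms] by (intro integral_cong_AE) auto
  finally show ?thesis by simp
qed

lemma L2_on_diff: "f \<in> L2_on \<Omega> \<Longrightarrow> g \<in> L2_on \<Omega> \<Longrightarrow> f - g \<in> L2_on \<Omega>"
  using AE_rep_l2_diff[of f g] by (auto simp: L2_on_def)

lemma L2_on_zero: "0 \<in> L2_on \<Omega>"
  using AE_rep_l2_zero by (auto simp: L2_on_def)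

section \<open>Test functions as elements of L2\<close>

lemma test_function_smooth: "\<phi> \<in> test_functions \<Omega> \<Longrightarrow> C_k_on k UNIV \<phi>"
  by (simp add: test_functions_def)

lemma test_function_differentiable: "\<phi> \<in> test_functions \<Omega> \<Longrightarrow> \<phi> differentiable (at x)"
  using test_function_smooth[of \<phi> \<Omega> 1] by simp

lemma test_function_continuous: "\<phi> \<in> test_functions \<Omega> \<Longrightarrow> continuous_on S \<phi>"
  using test_function_smooth[of \<phi> \<Omega> 0] by (auto intro: continuous_on_subset)

lemma partial_eq_0_off_support:
  assumes "closed K" "\<And>x. x \<notin> K \<Longrightarrow> f x = 0" "x \<notin> K"
  shows "partial b f x = 0"
  using assms by (intro extend_by_zero(4)[of UNIV K]) auto

lemma test_function_partial:
  assumes "\<phi> \<in> test_functions \<Omega>" "b \<in> Basis"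
  shows "partial b \<phi> \<in> test_functions \<Omega>"
proof -
  obtain K where K: "compact K" "K \<subseteq> \<Omega>" "\<And>x. x \<notin> K \<Longrightarrow> \<phi> x = 0"
    using assms by (auto simp: test_functions_def)
  have "partial b \<phi> x = 0" if "x \<notin> K" for x
    using partial_eq_0_off_support[OF compact_imp_closed[OF K(1)] K(3) that] by simp
  moreover have "C_k_on k UNIV (partial b \<phi>)" for k
    using test_function_smooth[OF assms(1), of "Suc k"] assms(2) by simp
  ultimately show ?thesis
    using K unfolding test_functions_def by blast
qed

lemma sq_integrable_test_function:
  assumes "\<phi> \<in> test_functions \<Omega>"
  shows "sq_integrable \<phi>"
proof -
  obtain K where K: "compact K" "\<And>x. x \<notin> K \<Longrightarrow> \<phi> x = 0"
    using assms by (auto simp: test_functions_def)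
  obtain c where c: "K \<subseteq> cbox (- c) c"
    using bounded_subset_cbox_symmetric[OF compact_imp_bounded[OF K(1)]] by metis
  have "integrable lborel (\<lambda>x. (\<phi> x)\<^sup>2)"
    using K(2) c test_function_continuous[OF assms]
    by (intro lborel_integral_eq_cbox(1)[of "- c" c]) (auto intro!: continuous_intros)
  then show ?thesis
    using test_function_continuous[OF assms, of UNIV]
    by (auto simp: sq_integrable_def intro: borel_measurable_continuous_onI)
qed

lemma zero_test_function: "(\<lambda>_. 0) \<in> test_functions \<Omega>"
  by (auto simp: test_functions_def C_k_on_const intro!: exI[of _ "{}"])

lemma abs_l2_test_function:
  assumes "\<phi> \<in> test_functions \<Omega>"
  shows "abs_l2 \<phi> \<in> L2_on \<Omega>"
proof -
  have off: "\<phi> x = 0" if "x \<notin> \<Omega>" for x using assms that by (auto simp: test_functions_def)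
  show ?thesis
    using AE_rep_abs_l2[OF sq_integrable_test_function[OF assms]]
    unfolding L2_on_def mem_Collect_eq by eventually_elim (simp add: off)
qed

text \<open>In terms of the inner product, linearity of weak derivatives follows without any
  handling of representatives.\<close>

lemma is_weak_partial_iff_inner:
  assumes "b \<in> Basis"
  shows "is_weak_partial \<Omega> b f g \<longleftrightarrow> g \<in> L2_on \<Omega> \<and>
    (\<forall>\<phi>\<in>test_functions \<Omega>. f \<bullet> abs_l2 (partial b \<phi>) = - (g \<bullet> abs_l2 \<phi>))"
proof -
  have "(\<integral>x. rep_l2 f x * partial b \<phi> x \<partial>lborel) = f \<bullet> abs_l2 (partial b \<phi>)"
    "(\<integral>x. rep_l2 g x * \<phi> x \<partial>lborel) = g \<bullet> abs_l2 \<phi>" if "\<phi> \<in> test_functions \<Omega>" for \<phi>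
    using that sq_integrable_test_function[OF test_function_partial[OF that assms]]
    by (auto intro!: integral_rep_l2_mult intro: sq_integrable_test_function)
  then show ?thesis unfolding is_weak_partial_def by simp
qed

text \<open>On \<open>\<Omega>\<close> the difference is orthogonal to all test functions; off
  \<open>\<Omega>\<close> both candidates vanish by membership in
  \<open>L2_on \<Omega>\<close>.\<close>

lemma is_weak_partial_unique:
  assumes "open \<Omega>" "is_weak_partial \<Omega> b f g" "is_weak_partial \<Omega> b f h"
  shows "g = h"
proof (rule l2_eqI)
  have L2: "g \<in> L2_on \<Omega>" "h \<in> L2_on \<Omega>"
    using assms by (auto simp: is_weak_partial_def)
  have "AE x in lborel. x \<in> \<Omega> \<longrightarrow> rep_l2 g x - rep_l2 h x = 0"
  proof (rule AE_eq_0_if_test_functions[OF assms(1)])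
    show "sq_integrable (\<lambda>x. rep_l2 g x - rep_l2 h x)"
      by (intro sq_integrable_diff sq_integrable_rep_l2)
    fix \<phi> assume \<phi>: "\<phi> \<in> test_functions \<Omega>"
    have "integrable lborel (\<lambda>x. rep_l2 k x * \<phi> x)" for k
      by (intro sq_integrable_mult sq_integrable_rep_l2 sq_integrable_test_function[OF \<phi>])
    then have "(\<integral>x. (rep_l2 g x - rep_l2 h x) * \<phi> x \<partial>lborel)
        = (\<integral>x. rep_l2 g x * \<phi> x \<partial>lborel) - (\<integral>x. rep_l2 h x * \<phi> x \<partial>lborel)"
      by (simp add: left_diff_distrib)
    also have "\<dots> = 0"
      using assms \<phi> unfolding is_weak_partial_def by (metis add.inverse_inverse diff_self)
    finally show "(\<integral>x. (rep_l2 g x - rep_l2 h x) * \<phi> x \<partial>lborel) = 0" .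
  qed
  then show "AE x in lborel. rep_l2 g x = rep_l2 h x"
    using L2 unfolding L2_on_def mem_Collect_eq by eventually_elim auto
qed

lemma weak_partial_eq:
  assumes "open \<Omega>" "is_weak_partial \<Omega> b f g"
  shows "weak_partial \<Omega> b f = g"
  unfolding weak_partial_def
  by (rule the_equality) (use is_weak_partial_unique assms in blast)+

lemma is_weak_partial_diff:
  assumes "b \<in> Basis" "is_weak_partial \<Omega> b f g" "is_weak_partial \<Omega> b f' g'"
  shows "is_weak_partial \<Omega> b (f - f') (g - g')"
  using assms by (simp add: is_weak_partial_iff_inner L2_on_diff inner_diff_left)

lemma is_weak_partial_zero: "b \<in> Basis \<Longrightarrow> is_weak_partial \<Omega> b 0 0"
  by (simp add: is_weak_partial_iff_inner L2_on_zero)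

text \<open>Integration by parts: the derivative of the compactly supported product \<phi> \<psi>
  integrates to 0.\<close>

lemma is_weak_partial_test_function:
  assumes "\<phi> \<in> test_functions \<Omega>" "b \<in> Basis"
  shows "is_weak_partial \<Omega> b (abs_l2 \<phi>) (abs_l2 (partial b \<phi>))"
proof -
  note \<phi>' = test_function_partial[OF assms]
  have "abs_l2 \<phi> \<bullet> abs_l2 (partial b \<psi>) = - (abs_l2 (partial b \<phi>) \<bullet> abs_l2 \<psi>)"
    if \<psi>: "\<psi> \<in> test_functions \<Omega>" for \<psi>
  proof -
    note \<psi>' = test_function_partial[OF \<psi> assms(2)]
    obtain K where K: "compact K" "\<And>x. x \<notin> K \<Longrightarrow> \<phi> x = 0"
      using assms by (auto simp: test_functions_def)
    have part: "partial b (\<lambda>x. \<phi> x * \<psi> x) = (\<lambda>x. \<phi> x * partial b \<psi> x + partial b \<phi> x * \<psi> x)"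
      by (intro ext partial_mult test_function_differentiable[OF assms(1)] test_function_differentiable[OF \<psi>])
    have "(\<integral>x. partial b (\<lambda>x. \<phi> x * \<psi> x) x \<partial>lborel) = 0"
    proof (rule integral_partial_eq_0[OF _ _ K(1)])
      show "(\<lambda>x. \<phi> x * \<psi> x) differentiable (at x)" for x
        by (intro differentiable_mult test_function_differentiable[OF assms(1)] test_function_differentiable[OF \<psi>])
      show "continuous_on UNIV (partial b (\<lambda>x. \<phi> x * \<psi> x))"
        unfolding part
        by (intro continuous_intros test_function_continuous[OF assms(1)] test_function_continuous[OF \<psi>]
            test_function_continuous[OF \<phi>'] test_function_continuous[OF \<psi>'])
    qed (use K in auto)
    moreover have "integrable lborel (\<lambda>x. \<phi> x * partial b \<psi> x)" "integrable lborel (\<lambda>x. partial b \<phi> x * \<psi> x)"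
      using assms \<psi> \<phi>' \<psi>' by (auto intro!: sq_integrable_mult intro: sq_integrable_test_function)
    ultimately have *: "(\<integral>x. \<phi> x * partial b \<psi> x \<partial>lborel) = - (\<integral>x. partial b \<phi> x * \<psi> x \<partial>lborel)"
      unfolding part by simp
    have inner: "abs_l2 f \<bullet> abs_l2 g = (\<integral>x. f x * g x \<partial>lborel)"
      if "f \<in> test_functions \<Omega>" "g \<in> test_functions \<Omega>" for f g
    proof -
      note s = sq_integrable_test_function[OF that(1)] sq_integrable_test_function[OF that(2)]
      have "abs_l2 f \<bullet> abs_l2 g = (\<integral>x. rep_l2 (abs_l2 f) x * g x \<partial>lborel)"
        by (rule integral_rep_l2_mult[OF s(2), symmetric])
      also have "\<dots> = (\<integral>x. f x * g x \<partial>lborel)"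
        using s sq_integrable_rep_l2[of "abs_l2 f"] AE_rep_abs_l2[OF s(1)]
        by (intro integral_cong_AE) (auto simp: sq_integrable_def)
      finally show ?thesis .
    qed
    show ?thesis using * by (simp add: inner assms \<psi> \<phi>' \<psi>')
  qed
  then show ?thesis
    using assms(2) abs_l2_test_function[OF \<phi>'] by (simp add: is_weak_partial_iff_inner)
qed

text \<open>\<open>H2\<close> only provides witnesses; uniqueness identifies them with the
  \<open>THE\<close> terms that occur in \<open>H2_norm\<close> and
  \<open>weak_laplacian\<close>.\<close>

lemma H2D:
  assumes "open \<Omega>" "f \<in> H2 \<Omega>" "b \<in> Basis"
  shows "is_weak_partial \<Omega> b f (weak_partial \<Omega> b f)"
    and "b' \<in> Basis \<Longrightarrow> is_weak_partial \<Omega> b' (weak_partial \<Omega> b f) (weak_partial \<Omega> b' (weak_partial \<Omega> b f))"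
proof -
  obtain g where g: "is_weak_partial \<Omega> b f g" "\<And>b'. b' \<in> Basis \<Longrightarrow> \<exists>h. is_weak_partial \<Omega> b' g h"
    using assms(2,3) unfolding H2_def by blast
  have eq: "weak_partial \<Omega> b f = g" by (rule weak_partial_eq[OF assms(1) g(1)])
  show "is_weak_partial \<Omega> b f (weak_partial \<Omega> b f)" using g eq by simp
  show "is_weak_partial \<Omega> b' (weak_partial \<Omega> b f) (weak_partial \<Omega> b' (weak_partial \<Omega> b f))" if "b' \<in> Basis"
    unfolding eq using g(2)[OF that] weak_partial_eq[OF assms(1)] by auto
qed

lemma test_function_H2:
  assumes "\<phi> \<in> test_functions \<Omega>"
  shows "abs_l2 \<phi> \<in> H2 \<Omega>"
  using assms unfolding H2_def
  by (auto intro!: abs_l2_test_function exI is_weak_partial_test_function test_function_partial)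

lemma weak_laplacian_test_function:
  assumes "open \<Omega>" "\<phi> \<in> test_functions \<Omega>"
  shows "weak_laplacian \<Omega> (abs_l2 \<phi>) = (\<Sum>b\<in>Basis. abs_l2 (partial b (partial b \<phi>)))"
  unfolding weak_laplacian_def
proof (rule sum.cong[OF refl])
  fix b :: 'a assume b: "b \<in> Basis"
  note \<phi>' = test_function_partial[OF assms(2) b]
  show "weak_partial \<Omega> b (weak_partial \<Omega> b (abs_l2 \<phi>)) = abs_l2 (partial b (partial b \<phi>))"
    using weak_partial_eq[OF assms(1) is_weak_partial_test_function[OF assms(2) b]]
      weak_partial_eq[OF assms(1) is_weak_partial_test_function[OF \<phi>' b]] by simp
qed

lemma weak_laplacian_diff:
  assumes "open \<Omega>" "f \<in> H2 \<Omega>" "g \<in> H2 \<Omega>"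
  shows "weak_laplacian \<Omega> (f - g) = weak_laplacian \<Omega> f - weak_laplacian \<Omega> g"
  unfolding weak_laplacian_def sum_subtractf[symmetric]
proof (rule sum.cong[OF refl])
  fix b :: 'a assume b: "b \<in> Basis"
  note f = H2D[OF assms(1,2) b] and g = H2D[OF assms(1,3) b]
  have "weak_partial \<Omega> b (f - g) = weak_partial \<Omega> b f - weak_partial \<Omega> b g"
    by (rule weak_partial_eq[OF assms(1) is_weak_partial_diff[OF b f(1) g(1)]])
  then show "weak_partial \<Omega> b (weak_partial \<Omega> b (f - g)) =
      weak_partial \<Omega> b (weak_partial \<Omega> b f) - weak_partial \<Omega> b (weak_partial \<Omega> b g)"
    using weak_partial_eq[OF assms(1) is_weak_partial_diff[OF b f(2)[OF b] g(2)[OF b]]] by simp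
qed

text \<open>Each of the \<open>DIM('a)\<close> pure second derivatives is among the terms of
  \<open>H2_norm\<close>. The bound makes v \<mapsto> w . Lap v continuous in this norm.\<close>

lemma norm_weak_laplacian_le:
  "norm (weak_laplacian \<Omega> (f :: 'a::euclidean_space l2)) \<le> real DIM('a) * H2_norm \<Omega> f"
proof -
  have "norm (weak_partial \<Omega> b (weak_partial \<Omega> b f)) \<le> H2_norm \<Omega> f" if b: "b \<in> Basis" for b
    unfolding H2_norm_def
  proof (rule real_le_rsqrt)
    have "(norm (weak_partial \<Omega> b (weak_partial \<Omega> b f)))\<^sup>2
        \<le> (\<Sum>b'\<in>Basis. (norm (weak_partial \<Omega> b' (weak_partial \<Omega> b f)))\<^sup>2)"
      using b by (intro member_le_sum) auto
    also have "\<dots> \<le> (\<Sum>b\<in>Basis. \<Sum>b'\<in>Basis. (norm (weak_partial \<Omega> b' (weak_partial \<Omega> b f)))\<^sup>2)"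
      using b by (intro member_le_sum[of b Basis "\<lambda>b. \<Sum>b'\<in>Basis. (norm (weak_partial \<Omega> b' (weak_partial \<Omega> b f)))\<^sup>2"])
        (auto intro: sum_nonneg)
    also have "\<dots> \<le> (norm f)\<^sup>2 + (\<Sum>b\<in>Basis. (norm (weak_partial \<Omega> b f))\<^sup>2)
        + (\<Sum>b\<in>Basis. \<Sum>b'\<in>Basis. (norm (weak_partial \<Omega> b' (weak_partial \<Omega> b f)))\<^sup>2)"
      by (simp add: sum_nonneg)
    finally show "(norm (weak_partial \<Omega> b (weak_partial \<Omega> b f)))\<^sup>2 \<le> (norm f)\<^sup>2
        + (\<Sum>b\<in>Basis. (norm (weak_partial \<Omega> b f))\<^sup>2)
        + (\<Sum>b\<in>Basis. \<Sum>b'\<in>Basis. (norm (weak_partial \<Omega> b' (weak_partial \<Omega> b f)))\<^sup>2)" .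
  qed
  then have "(\<Sum>b\<in>(Basis :: 'a set). norm (weak_partial \<Omega> b (weak_partial \<Omega> b f))) \<le> (\<Sum>b\<in>(Basis :: 'a set). H2_norm \<Omega> f)"
    by (rule sum_mono)
  then show ?thesis
    unfolding weak_laplacian_def by (intro order_trans[OF norm_sum]) simp
qed

section \<open>Harmonic functions lie in the kernel of B\<close>

lemma integral_harmonic_mult_laplacian_eq_0:
  assumes "open \<Omega>" and f: "harmonic_on \<Omega> f" and \<phi>: "\<phi> \<in> test_functions \<Omega>"
  shows "(\<integral>x. f x * (\<Sum>b\<in>Basis. partial b (partial b \<phi>) x) \<partial>lborel) = 0"
proof -
  obtain K where K: "compact K" "K \<subseteq> \<Omega>" "\<And>x. x \<notin> K \<Longrightarrow> \<phi> x = 0"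
    using \<phi> by (auto simp: test_functions_def)
  note off = partial_eq_0_off_support[OF compact_imp_closed[OF K(1)]]
  have "C_k_on 2 \<Omega> f" and lap: "\<And>x. x \<in> \<Omega> \<Longrightarrow> (\<Sum>b\<in>Basis. partial b (partial b f) x) = 0"
    using f by (auto simp: harmonic_on_def)
  note D = C2_onD[OF this(1)] and E = C2_onD[OF test_function_smooth[OF \<phi>]]
  \<comment> \<open>The field of Green's second identity, with \<phi> as its own cutoff: its
    divergence is f Lap \<phi> - \<phi> Lap f.\<close>
  define P where "P b x = f x * partial b \<phi> x - \<phi> x * partial b f x" for b x
  have P0: "P b x = 0" if "x \<notin> K" for b x
    using that by (simp add: P_def K off[OF K(3)])
  have dP: "P b differentiable (at x)"
    "partial b (P b) x = f x * partial b (partial b \<phi>) x - \<phi> x * partial b (partial b f) x"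
    if "b \<in> Basis" "x \<in> \<Omega>" for b x
    using that D(1,2)[of x] E(1,2)[of x]
    by (auto simp: P_def[abs_def] partial_diff partial_mult)
  have "(\<integral>x. (\<Sum>b\<in>Basis. partial b (P b) x) \<partial>lborel) = 0"
  proof (rule integral_divergence_eq_0[OF assms(1) K(1,2) P0 dP(1)])
    show "continuous_on \<Omega> (partial b (P b))" if "b \<in> Basis" for b
    proof (rule continuous_on_eq)
      show "continuous_on \<Omega> (\<lambda>x. f x * partial b (partial b \<phi>) x - \<phi> x * partial b (partial b f) x)"
        using that by (intro continuous_intros D continuous_on_subset[OF E(3)] continuous_on_subset[OF E(4)]) auto
    qed (use dP that in simp)
  qed auto
  also have "(\<lambda>x. (\<Sum>b\<in>Basis. partial b (P b) x)) = (\<lambda>x. f x * (\<Sum>b\<in>Basis. partial b (partial b \<phi>) x))"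
  proof
    fix x
    show "(\<Sum>b\<in>Basis. partial b (P b) x) = f x * (\<Sum>b\<in>Basis. partial b (partial b \<phi>) x)"
    proof (cases "x \<in> \<Omega>")
      case True
      then have "(\<Sum>b\<in>Basis. partial b (P b) x)
          = f x * (\<Sum>b\<in>Basis. partial b (partial b \<phi>) x) - \<phi> x * (\<Sum>b\<in>Basis. partial b (partial b f) x)"
        by (simp add: dP sum_subtractf sum_distrib_left)
      with lap[OF True] show ?thesis by simp
    next
      case False
      then have "x \<notin> K" using K by auto
      then show ?thesis using off[OF P0] off[OF off[OF K(3)]] by simp
    qed
  qed
  finally show ?thesis .
qed

text \<open>For test functions this is Green's identity. They approximate each element of
  \<open>H20 \<Omega>\<close> in the H2 norm, and \<open>norm_weak_laplacian_le\<close> carries the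
  identity over.\<close>

lemma inner_harmonic_weak_laplacian_eq_0:
  assumes \<Omega>: "open \<Omega>" and w: "w \<in> harmonic_L2 \<Omega>" and v: "v \<in> H20 \<Omega>"
  shows "w \<bullet> weak_laplacian \<Omega> v = 0"
proof -
  obtain f where f: "harmonic_on \<Omega> f" "AE x in lborel. x \<in> \<Omega> \<longrightarrow> rep_l2 w x = f x"
    using w by (auto simp: harmonic_L2_def)
  have test: "w \<bullet> weak_laplacian \<Omega> (abs_l2 \<phi>) = 0" if \<phi>: "\<phi> \<in> test_functions \<Omega>" for \<phi>
  proof -
    have \<phi>'': "partial b (partial b \<phi>) \<in> test_functions \<Omega>" if "b \<in> Basis" for b
      using \<phi> that by (intro test_function_partial)
    note s = sq_integrable_test_function[OF \<phi>'']
    have "w \<bullet> weak_laplacian \<Omega> (abs_l2 \<phi>) = (\<Sum>b\<in>Basis. \<integral>x. rep_l2 w x * partial b (partial b \<phi>) x \<partial>lborel)"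
      by (simp add: weak_laplacian_test_function[OF \<Omega> \<phi>] inner_sum_right integral_rep_l2_mult[OF s])
    also have "\<dots> = (\<integral>x. rep_l2 w x * (\<Sum>b\<in>Basis. partial b (partial b \<phi>) x) \<partial>lborel)"
      unfolding sum_distrib_left
      by (rule Bochner_Integration.integral_sum[symmetric]) (intro sq_integrable_mult sq_integrable_rep_l2 s)
    also have "\<dots> = (\<integral>x. f x * (\<Sum>b\<in>Basis. partial b (partial b \<phi>) x) \<partial>lborel)"
    proof (rule integral_cong_AE)
      have [measurable]: "rep_l2 w \<in> borel_measurable lborel"
        "b \<in> Basis \<Longrightarrow> partial b (partial b \<phi>) \<in> borel_measurable lborel" for b
        using sq_integrable_rep_l2[of w] s[of b] by (auto simp: sq_integrable_def)
      show "(\<lambda>x. rep_l2 w x * (\<Sum>b\<in>Basis. partial b (partial b \<phi>) x)) \<in> borel_measurable lborel"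
        by measurable
      have outside: "partial b (partial b \<phi>) x = 0" if "b \<in> Basis" "x \<notin> \<Omega>" for b x
        using \<phi>''[OF that(1)] that(2) by (auto simp: test_functions_def)
      show "AE x in lborel. rep_l2 w x * (\<Sum>b\<in>Basis. partial b (partial b \<phi>) x)
          = f x * (\<Sum>b\<in>Basis. partial b (partial b \<phi>) x)"
        using f(2) by eventually_elim (auto simp: outside)
      obtain K where K: "compact K" "K \<subseteq> \<Omega>" "\<And>x. x \<notin> K \<Longrightarrow> \<phi> x = 0"
        using \<phi> by (auto simp: test_functions_def)
      note off = partial_eq_0_off_support[OF compact_imp_closed[OF K(1)]]
      \<comment> \<open>Off \<open>\<Omega>\<close> the function f is arbitrary, possibly not
        measurable. The product is continuous, since its other factor vanishes off K.\<close>
      have "continuous_on UNIV (\<lambda>x. f x * (\<Sum>b\<in>Basis. partial b (partial b \<phi>) x))"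
      proof (rule extend_by_zero(2)[OF \<Omega> compact_imp_closed[OF K(1)] K(2)])
        show "f x * (\<Sum>b\<in>Basis. partial b (partial b \<phi>) x) = 0" if "x \<notin> K" for x
          using that by (simp add: off[OF off[OF K(3)]])
        show "continuous_on \<Omega> (\<lambda>x. f x * (\<Sum>b\<in>Basis. partial b (partial b \<phi>) x))"
          using f(1) by (intro continuous_intros C2_onD(4) test_function_continuous[OF \<phi>'']) (auto simp: harmonic_on_def)
      qed
      then show "(\<lambda>x. f x * (\<Sum>b\<in>Basis. partial b (partial b \<phi>) x)) \<in> borel_measurable lborel"
        by (simp add: borel_measurable_continuous_onI)
    qed
    also have "\<dots> = 0" by (rule integral_harmonic_mult_laplacian_eq_0[OF \<Omega> f(1) \<phi>])
    finally show ?thesis .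
  qed
  have vH2: "v \<in> H2 \<Omega>" using v by (simp add: H20_def)
  have bound: "\<bar>w \<bullet> weak_laplacian \<Omega> v\<bar> \<le> norm w * real DIM('a) * e" if "e > 0" for e
  proof -
    obtain \<phi> where \<phi>: "\<phi> \<in> test_functions \<Omega>" "H2_norm \<Omega> (v - abs_l2 \<phi>) < e"
      using v \<open>e > 0\<close> by (auto simp: H20_def)
    have "w \<bullet> weak_laplacian \<Omega> v = w \<bullet> weak_laplacian \<Omega> (v - abs_l2 \<phi>)"
      by (simp add: weak_laplacian_diff[OF \<Omega> vH2 test_function_H2[OF \<phi>(1)]] inner_diff_right test[OF \<phi>(1)])
    also have "\<bar>\<dots>\<bar> \<le> norm w * norm (weak_laplacian \<Omega> (v - abs_l2 \<phi>))"
      by (rule Cauchy_Schwarz_ineq2)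
    also have "\<dots> \<le> norm w * (real DIM('a) * e)"
      using norm_weak_laplacian_le[of \<Omega> "v - abs_l2 \<phi>"] \<phi>(2)
      by (intro mult_left_mono) (auto intro: order_trans mult_left_mono)
    finally show ?thesis by (simp add: mult.assoc)
  qed
  have "((\<lambda>e. norm w * real DIM('a) * e) \<longlongrightarrow> norm w * real DIM('a) * 0) (at_right 0)"
    by (intro tendsto_intros)
  then have "\<bar>w \<bullet> weak_laplacian \<Omega> v\<bar> \<le> norm w * real DIM('a) * 0"
    by (rule tendsto_lowerbound) (auto simp: eventually_at_filter bound)
  then show ?thesis by simp
qed

text \<open>Keeps the supremum in \<open>Hm2_norm\<close> from ranging over the empty set, so that
  the zero functional really has norm 0.\<close>

lemma zero_H20:
  assumes "open \<Omega>"
  shows "0 \<in> H20 \<Omega>" and "H2_norm \<Omega> 0 = 0"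
proof -
  have wp: "weak_partial \<Omega> b 0 = 0" if "b \<in> Basis" for b
    by (rule weak_partial_eq[OF assms is_weak_partial_zero[OF that]])
  then show norm: "H2_norm \<Omega> 0 = 0" by (simp add: H2_norm_def)
  have "0 = abs_l2 (\<lambda>_::'a. 0)" by (simp add: zero_l2_def)
  then show "0 \<in> H20 \<Omega>"
    using test_function_H2[OF zero_test_function, of \<Omega>] zero_test_function[of \<Omega>] norm
    by (auto simp: H20_def intro!: bexI[of _ "\<lambda>_. 0"])
qed

subsection \<open>The estimate at zero data\<close>

lemma Hm2_norm_zero:
  assumes "open \<Omega>"
  shows "Hm2_norm \<Omega> (\<lambda>_. 0) = 0"
proof -
  have "{v \<in> H20 \<Omega>. H2_norm \<Omega> v \<le> 1} \<noteq> {}" using zero_H20[OF assms] by auto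
  then show ?thesis by (simp add: Hm2_norm_def)
qed

lemma zero_Hm2: "(\<lambda>_. 0) \<in> Hm2 \<Omega>"
  by (auto simp: Hm2_def intro!: exI[of _ 0])

lemma L2_norm_restr: "S \<in> sets borel \<Longrightarrow> L2_norm S (restr S f) = L2_norm S f"
proof -
  assume S: "S \<in> sets borel"
  have "restr S (restr S f) = restr S f"
    by (rule l2_eqI)
       (use AE_rep_l2_restr[OF S, of f] AE_rep_l2_restr[OF S, of "restr S f"] in \<open>eventually_elim; simp add: indicator_def\<close>)
  then show ?thesis by (simp add: L2_norm_def)
qed

lemma E_data_harmonic:
  assumes "open \<Omega>" "open \<omega>" "w \<in> harmonic_L2 \<Omega>"
  shows "E_data \<Omega> \<omega> w (\<lambda>_. 0, 0) = L2_norm \<omega> w"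
proof -
  have "op_B \<Omega> w = (\<lambda>_. 0)"
    using inner_harmonic_weak_laplacian_eq_0[OF assms(1,3)] by (auto simp: op_B_def)
  then show ?thesis
    using assms by (simp add: E_data_def op_A_def data_norm_def Hm2_norm_zero L2_norm_restr) (simp add: L2_norm_def)
qed

section \<open>Comparison and positivity of L2 norms\<close>

lemma norm_l2_mono:
  assumes "AE x in lborel. \<bar>rep_l2 f x\<bar> \<le> \<bar>rep_l2 g x\<bar>"
  shows "norm f \<le> norm g"
proof -
  have "(\<integral>x. rep_l2 f x * rep_l2 f x \<partial>lborel) \<le> (\<integral>x. rep_l2 g x * rep_l2 g x \<partial>lborel)"
  proof (rule integral_mono_AE)
    show "AE x in lborel. rep_l2 f x * rep_l2 f x \<le> rep_l2 g x * rep_l2 g x"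
      using assms by eventually_elim (simp add: abs_le_square_iff power2_eq_square)
  qed (intro sq_integrable_mult sq_integrable_rep_l2)+
  then show ?thesis by (simp add: norm_l2_def inner_l2_def)
qed

lemma L2_norm_mono:
  assumes "S \<in> sets borel" "T \<in> sets borel" "S \<subseteq> T"
  shows "L2_norm S f \<le> L2_norm T f"
  unfolding L2_norm_def
  by (rule norm_l2_mono)
     (use AE_rep_l2_restr[OF assms(1), of f] AE_rep_l2_restr[OF assms(2), of f]
       in \<open>eventually_elim; use assms(3) in \<open>auto simp: indicator_def\<close>\<close>)

lemma L2_norm_le_norm:
  assumes "S \<in> sets borel"
  shows "L2_norm S f \<le> norm f"
  unfolding L2_norm_def
  by (rule norm_l2_mono)
     (use AE_rep_l2_restr[OF assms, of f] in \<open>eventually_elim; auto simp: indicator_def\<close>)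

text \<open>If the norm were 0, the harmonic representative would vanish almost everywhere on
  \<open>\<omega>\<close>, everywhere there by continuity, and on \<open>\<Omega>\<close> by unique
  continuation. Off \<open>\<Omega>\<close> the class w is 0 by definition.\<close>

lemma L2_norm_harmonic_pos:
  assumes \<Omega>: "open \<Omega>" "connected \<Omega>" and \<omega>: "open \<omega>" "\<omega> \<noteq> {}" "\<omega> \<subseteq> \<Omega>"
    and w: "w \<in> harmonic_L2 \<Omega>" "w \<noteq> 0"
  shows "0 < L2_norm \<omega> w"
proof (rule ccontr)
  assume "\<not> 0 < L2_norm \<omega> w"
  then have "restr \<omega> w = 0" by (simp add: L2_norm_def)
  then have "AE x in lborel. x \<in> \<omega> \<longrightarrow> rep_l2 w x = 0"
    using AE_rep_l2_restr[of \<omega> w] AE_rep_l2_zero \<omega>(1) by (auto simp: indicator_def)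
  moreover obtain f where f: "harmonic_on \<Omega> f" "AE x in lborel. x \<in> \<Omega> \<longrightarrow> rep_l2 w x = f x"
    using w by (auto simp: harmonic_L2_def)
  ultimately have ae: "AE x in lborel. x \<in> \<omega> \<longrightarrow> f x = 0"
    using \<omega>(3) by (auto elim: eventually_elim2)
  have "continuous_on \<omega> f"
    using f(1) \<omega>(3) by (auto simp: harmonic_on_def intro: continuous_on_subset[OF C2_onD(4)])
  then have "f x = 0" if "x \<in> \<omega>" for x
    using continuous_AE_eq_0[OF \<omega>(1) _ ae that] by simp
  then have zero: "f x = 0" if "x \<in> \<Omega>" for x
    using harmonic_unique_continuation[OF \<Omega> f(1) \<omega> _ that] by blast
  have "AE x in lborel. x \<notin> \<Omega> \<longrightarrow> rep_l2 w x = 0"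
    using w by (simp add: harmonic_L2_def L2_on_def)
  then have "AE x in lborel. rep_l2 w x = rep_l2 0 x"
    using f(2) AE_rep_l2_zero by eventually_elim (use zero in auto)
  with w(2) show False using l2_eqI by blast
qed

lemma E_appr_nonneg:
  assumes "X \<noteq> {}"
  shows "0 \<le> E_appr \<Omega> X u"
  unfolding E_appr_def using assms by (intro cINF_greatest) (auto simp: L2_norm_def)

lemma E_appr_le:
  assumes "z \<in> X" "\<Omega> \<in> sets borel"
  shows "E_appr \<Omega> X u \<le> norm (u - z)"
proof -
  have "E_appr \<Omega> X u \<le> L2_norm \<Omega> (u - z)"
    unfolding E_appr_def using assms(1)
    by (intro cINF_lower bdd_belowI2[of _ 0]) (auto simp: L2_norm_def)
  also have "\<dots> \<le> norm (u - z)" by (rule L2_norm_le_norm[OF assms(2)])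
  finally show ?thesis .
qed

lemma is_exponent_le_alpha_hat:
  assumes "\<And>w. w \<in> harmonic_L2 \<Omega> \<Longrightarrow> w \<noteq> 0 \<Longrightarrow>
    L2_norm G w \<le> C * L2_norm \<omega> w powr \<alpha> * L2_norm \<Omega> w powr (1 - \<alpha>)"
  shows "ereal \<alpha> \<le> alpha_hat \<omega> G \<Omega>"
  unfolding alpha_hat_def using assms by (intro Sup_upper imageI) blast

theorem mainTheorem4:
  fixes \<omega> G \<Omega> :: "(real ^ 'n) set"
    and I :: "'i set"
    and X :: "'i \<Rightarrow> (real ^ 'n) l2 set"
    and \<alpha>' :: real
  assumes "bounded_domain \<omega>" "bounded_domain G" "bounded_domain \<Omega>"
    and "\<omega> \<subseteq> G" "compactly_inside G \<Omega>"
    and "\<And>\<delta>. \<delta> \<in> I \<Longrightarrow> subspace (X \<delta>) \<and> X \<delta> \<subseteq> L2_on \<Omega>"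
    and "\<And>\<delta>. \<delta> \<in> I \<Longrightarrow> \<exists>B. finite B \<and> X \<delta> = span B"
    and "L2_on \<Omega> \<subseteq> closure (\<Union>\<delta>\<in>I. X \<delta>)"
    and "ereal \<alpha>' > alpha_hat \<omega> G \<Omega>"
  shows "\<not> (\<exists>U. is_scheme \<Omega> \<omega> I X U
     \<and> (\<forall>\<delta>\<in>I. U (\<lambda>_. 0, 0) \<delta> = 0)
     \<and> (\<exists>K::real. \<forall>\<delta>\<in>I. \<forall>l\<in>Hm2 \<Omega>. \<forall>q\<in>L2_on \<omega>. \<forall>u\<in>L2_on \<Omega>. u \<noteq> 0 \<longrightarrow>
          L2_norm G (u - U (l, q) \<delta>) \<le>
            K * (E_data \<Omega> \<omega> u (l, q) + E_appr \<Omega> (X \<delta>) u) powr \<alpha>'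
              * max (E_data \<Omega> \<omega> u (l, q) + E_appr \<Omega> (X \<delta>) u) (L2_norm \<Omega> u) powr (1 - \<alpha>')))"
proof (rule notI, elim exE conjE)
  fix U and K :: real
  assume U0: "\<forall>\<delta>\<in>I. U (\<lambda>_. 0, 0) \<delta> = 0"
    and est: "\<forall>\<delta>\<in>I. \<forall>l\<in>Hm2 \<Omega>. \<forall>q\<in>L2_on \<omega>. \<forall>u\<in>L2_on \<Omega>. u \<noteq> 0 \<longrightarrow>
          L2_norm G (u - U (l, q) \<delta>) \<le>
            K * (E_data \<Omega> \<omega> u (l, q) + E_appr \<Omega> (X \<delta>) u) powr \<alpha>'
              * max (E_data \<Omega> \<omega> u (l, q) + E_appr \<Omega> (X \<delta>) u) (L2_norm \<Omega> u) powr (1 - \<alpha>')"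
  have \<Omega>: "open \<Omega>" "connected \<Omega>" and \<omega>: "open \<omega>" "\<omega> \<noteq> {}" "\<omega> \<subseteq> \<Omega>"
    using assms(1-5) closure_subset[of G] by (auto simp: bounded_domain_def compactly_inside_def)
  have "L2_norm G w \<le> K * L2_norm \<omega> w powr \<alpha>' * L2_norm \<Omega> w powr (1 - \<alpha>')"
    if w: "w \<in> harmonic_L2 \<Omega>" "w \<noteq> 0" for w
  proof -
    let ?a = "L2_norm \<omega> w" and ?N = "L2_norm \<Omega> w"
    have wL2: "w \<in> L2_on \<Omega>" using w by (simp add: harmonic_L2_def)
    have a: "0 < ?a" by (rule L2_norm_harmonic_pos[OF \<Omega> \<omega> w])
    have aN: "?a \<le> ?N" using \<Omega> \<omega> by (intro L2_norm_mono) auto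
    \<comment> \<open>The family carries no order, so an index is chosen separately for each
      tolerance 1 / (n + 1).\<close>
    have "\<exists>\<delta>\<in>I. E_appr \<Omega> (X \<delta>) w < inverse (real (Suc n))" for n
    proof -
      have "w \<in> closure (\<Union>\<delta>\<in>I. X \<delta>)" using assms(8) wL2 by blast
      then obtain z where "z \<in> (\<Union>\<delta>\<in>I. X \<delta>)" "dist z w < inverse (real (Suc n))"
        using closure_approachable[of w] by (metis inverse_positive_iff_positive of_nat_0_less_iff zero_less_Suc)
      then show ?thesis
        using E_appr_le[of z _ \<Omega> w] \<Omega>(1) by (force simp: dist_norm norm_minus_commute)
    qed
    then obtain d where d: "\<And>n. d n \<in> I" "\<And>n. E_appr \<Omega> (X (d n)) w < inverse (real (Suc n))"
      by metis
    define e where "e n = E_appr \<Omega> (X (d n)) w" for n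
    have e0: "0 \<le> e n" for n
      unfolding e_def using assms(6)[OF d(1)] subspace_0 by (intro E_appr_nonneg) blast
    have "e \<longlonglongrightarrow> 0"
      using LIMSEQ_inverse_real_of_nat
      by (rule tendsto_sandwich[OF _ _ tendsto_const, rotated 2])
         (use e0 d(2) in \<open>auto simp: e_def less_imp_le\<close>)
    \<comment> \<open>Both bases have positive limits, so \<open>powr\<close> is continuous there
      whatever the sign of the exponents. Since \<open>?a \<le> ?N\<close>, the maximum tends to
      \<open>?N\<close>.\<close>
    then have "(\<lambda>n. K * (?a + e n) powr \<alpha>' * max (?a + e n) ?N powr (1 - \<alpha>'))
        \<longlonglongrightarrow> K * (?a + 0) powr \<alpha>' * max (?a + 0) ?N powr (1 - \<alpha>')"
      using a aN by (intro tendsto_intros) auto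
    moreover have "L2_norm G w \<le> K * (?a + e n) powr \<alpha>' * max (?a + e n) ?N powr (1 - \<alpha>')" for n
      using est[rule_format, OF d(1) zero_Hm2 L2_on_zero wL2 w(2), of n]
      by (simp add: U0[rule_format, OF d(1)] E_data_harmonic[OF \<Omega>(1) \<omega>(1) w(1)] e_def)
    ultimately have "L2_norm G w \<le> K * (?a + 0) powr \<alpha>' * max (?a + 0) ?N powr (1 - \<alpha>')"
      by (intro LIMSEQ_le_const) auto
    then show ?thesis using aN by (simp add: max_absorb2)
  qed
  then have "ereal \<alpha>' \<le> alpha_hat \<omega> G \<Omega>" by (rule is_exponent_le_alpha_hat)
  with assms(9) show False by simp
qed

end
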